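(* Let $\mathbf{S}$ be the random variable on the sampling space $S$ related to the random variable $\mathbf{X}$ on $\mathcal{M}$ by $f_\mu(f_\sigma(\mathbf{S}))=\mathbf{X}$, where $\mathbf{X}$ is assumed to have probability density function on $\mathcal{M}$ (with respect to the 2-dimensional surface measure) proportional to $\exp\left(-\frac{\chi^2(\mathbf{x})}{2}\right)$. Then, for each of the three sampling techniques, the probability density function of $\mathbf{S}$ is $$p_{\mathbf{S}}(\mathbf{s})=\frac{\exp\left(-\frac{\chi^2(\mathbf{s})}{2}\right)\sqrt{G_\mu(\mathbf{s})}\sqrt{G_\sigma(\mathbf{s})}}{\int_{f_\sigma^{-1}(K')}\exp\left(-\frac{\chi^2(\mathbf{s})}{2}\right)\sqrt{G_\mu(\mathbf{s})}\sqrt{G_\sigma(\mathbf{s})}\,d\mathbf{s}},$$ for $\mathbf{s}\in f_\sigma^{-1}(K')$, where $\chi^2(\mathbf{s})=\chi^2\big(f_\mu(f_\sigma(\mathbf{s}))\big)$, $G_\mu(\mathbf{s})=G_\mu(f_\sigma(\mathbf{s}))$, and $G_\sigma$ is the Gramian of the columns of $Df_\sigma(\mathbf{s})$, so that $\sqrt{G_\sigma(\mathbf{s})}=|\det Df_\sigma(\mathbf{s})|$.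
   Context: Spaces. $A=\mathbb{S}^1\times(-\pi/2,\pi/2)\times\mathbb{R}^2$ (attributables $\mathcal{A}$), $R=\mathbb{R}_{\ge 0}\times\mathbb{R}$ (pairs $\boldsymbol\rho=(\rho,\dot\rho)$), $\mathcal{X}=A\times R$ (orbits $\mathbf{x}=(\mathcal{A},\boldsymbol\rho)$; derivatives and surface measures are taken in these coordinates, locally identifying $\mathcal{X}$ with a subset of $\mathbb{R}^6$). The residuals space is $\mathbb{R}^m$, $m\ge 6$, $F:\mathcal{X}\to\mathbb{R}^m$, $\boldsymbol\xi(\mathbf{x})=F(\mathbf{x})$, is the sufficiently smooth map giving the normalised residuals, and $Q(\mathbf{x})=\frac1m\boldsymbol\xi(\mathbf{x})^\top\boldsymbol\xi(\mathbf{x})$ is the target function. Manifold Of Variations. $K'\subseteq R$ is the set of those $\boldsymbol\rho$ (in a given subset $K$ of a compact set of admissible values, the Admissible Region) for which the doubly constrained differential corrections (a Newton-type iteration on $\mathcal{A}$ for minimising $Q(\cdot,\boldsymbol\rho)$ with $\boldsymbol\rho$ fixed) converge, to a local minimiser $\mathcal{A}^*(\boldsymbol\rho)$ of $Q(\cdot,\boldsymbol\rho)$. The map $f_\mu(\boldsymbol\rho)=(\mathcal{A}^*(\boldsymbol\rho),\boldsymbol\rho)$ on $K'$ is at least $C^1$, and $\mathcal{M}=f_\mu(K')$ is a 2-dimensional submanifold of $\mathcal{X}$ globally parametrized by $f_\mu$. For $\mathbf{x}\in\mathcal{M}$, $\chi(\mathbf{x})=\sqrt{m(Q(\mathbf{x})-Q^*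 )}$ with $Q^*=\min_{\boldsymbol\rho\in K'}Q(\mathcal{A}^*(\boldsymbol\rho),\boldsymbol\rho)$. For $\boldsymbol\rho\in K'$, $$G_\mu(\boldsymbol\rho)=\det\left(I_2+\left(\frac{\partial\mathcal{A}^*}{\partial\boldsymbol\rho}(\boldsymbol\rho)\right)^\top\frac{\partial\mathcal{A}^*}{\partial\boldsymbol\rho}(\boldsymbol\rho)\right).$$ Sampling space $S$ and map $f_\sigma$ from $S$ to the $(\rho,\dot\rho)$ space, according to the sampling technique: (i) sampling uniform in $\rho$: $S=\mathbb{R}_{\ge0}\times\mathbb{R}$ and $f_\sigma$ is the identity; (ii) sampling uniform in $\log_{10}\rho$: $S=\mathbb{R}^2$ and $f_\sigma(x,y)=(10^x,y)$; (iii) cobweb sampling: $S=\mathbb{R}_{\ge0}\times\mathbb{S}^1$ and $$f_\sigma(r,\theta)=r\begin{pmatrix}\sqrt{\lambda_1}\cos\theta&-\sqrt{\lambda_2}\sin\theta\\ \sqrt{\lambda_2}\sin\theta&\sqrt{\lambda_1}\cos\theta\end{pmatrix}\mathbf{v}_1+\begin{pmatrix}\rho^*\\ \dot\rho^*\end{pmatrix},$$ where $(\rho^*,\dot\rho^* )$ is the range/range-rate part of the nominal (full least squares) orbit $\mathbf{x}^*$, $\lambda_1>\lambda_2>0$ are the eigenvalues of the $2\times2$ positive definite matrix $\Gamma_{\boldsymbol\rho\boldsymbol\rho}(\mathbf{x}^* )$, the restriction to the $(\rho,\dot\rho)$ space of the covariance matrix $\Gamma(\mathbf{x}^* )=\left(\frac{\partial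 F}{\partial\mathbf{x}}(\mathbf{x}^* )^\top\frac{\partial F}{\partial\mathbf{x}}(\mathbf{x}^* )\right)^{-1}$, and $\mathbf{v}_1$ is the unit eigenvector corresponding to $\lambda_1$. $K'$ is regarded as the set covered by the sampling, i.e. $f_\sigma$ maps $f_\sigma^{-1}(K')$ onto $K'$ (up to a set of measure zero), and $d\mathbf{s}$ is Lebesgue measure in the coordinates of $S$. *)

theory Defs
  imports "HOL-Probability.Probability"
begin

section \<open>Orbits\<close>

text \<open>
  An attributable consists of two angles and their rates. The first angle lives on the unit circle,
  which is the subset \<open>sphere 0 1\<close> of the complex plane. A pair (range, range rate) is a vector of
  \<open>real^2\<close>.
\<close>

type_synonym attributable = "complex \<times> real \<times> real \<times> real"
type_synonym orbit = "attributable \<times> (real^2)"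

definition attributables :: "attributable set" where
  "attributables = sphere 0 1 \<times> {-pi/2<..<pi/2} \<times> UNIV \<times> UNIV"

definition range_space :: "(real^2) set" where
  "range_space = {\<rho>. 0 \<le> \<rho> $ 1}"

definition orbits :: "orbit set" where
  "orbits = attributables \<times> range_space"

text \<open>
  The coordinates. The first one is an angle, determined modulo \<open>2 * pi\<close>; since \<open>cis\<close> parametrizes the
  circle by arc length, lengths and areas of subsets of \<open>orbits\<close> measured in the ambient Euclidean
  space agree with those measured in the coordinates.
\<close>

definition attr_of_coords :: "real^4 \<Rightarrow> attributable" where
  "attr_of_coords c = (cis (c $ 1), c $ 2, c $ 3, c $ 4)"

definition orbit_of_coords :: "real^6 \<Rightarrow> orbit" where
  "orbit_of_coords y = ((cis (y $ 1), y $ 2, y $ 3, y $ 4), vector [y $ 5, y $ 6])"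

definition coords_domain :: "(real^6) set" where
  "coords_domain = {y. - pi/2 < y $ 2 \<and> y $ 2 < pi/2 \<and> 0 \<le> y $ 5}"

definition coords_of_orbit :: "orbit \<Rightarrow> real^6" where
  "coords_of_orbit = (\<lambda>((u, d, a', d'), \<rho>). vector [Arg u, d, a', d', \<rho> $ 1, \<rho> $ 2])"


section \<open>Residuals and least squares\<close>

definition residual_jacobian :: "(orbit \<Rightarrow> real^'m) \<Rightarrow> real^6 \<Rightarrow> real^6^'m" where
  "residual_jacobian F y = jacobian (F \<circ> orbit_of_coords) (at y within coords_domain)"

definition C1_residuals :: "(orbit \<Rightarrow> real^'m) \<Rightarrow> bool" where
  "C1_residuals F \<longleftrightarrow>
     (F \<circ> orbit_of_coords) differentiable_on coords_domain \<and>
     continuous_on coords_domain (residual_jacobian F)"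

definition target :: "(orbit \<Rightarrow> real^'m) \<Rightarrow> orbit \<Rightarrow> real" where
  "target F x = (F x \<bullet> F x) / real CARD('m)"

definition local_minimiser_on :: "'a::metric_space set \<Rightarrow> ('a \<Rightarrow> real) \<Rightarrow> 'a \<Rightarrow> bool" where
  "local_minimiser_on S f a \<longleftrightarrow> a \<in> S \<and> (\<exists>e>0. \<forall>b\<in>S. dist b a < e \<longrightarrow> f a \<le> f b)"

definition normal_matrix :: "(orbit \<Rightarrow> real^'m) \<Rightarrow> orbit \<Rightarrow> real^6^6" where
  "normal_matrix F x =
     (let J = residual_jacobian F (coords_of_orbit x) in transpose J ** J)"

definition covariance_matrix :: "(orbit \<Rightarrow> real^'m) \<Rightarrow> orbit \<Rightarrow> real^6^6" where
  "covariance_matrix F x = matrix_inv (normal_matrix F x)"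

definition range_covariance :: "(orbit \<Rightarrow> real^'m) \<Rightarrow> orbit \<Rightarrow> real^2^2" where
  "range_covariance F x =
     (let \<Gamma> = covariance_matrix F x
      in vector [vector [\<Gamma> $ 5 $ 5, \<Gamma> $ 5 $ 6], vector [\<Gamma> $ 6 $ 5, \<Gamma> $ 6 $ 6]])"

text \<open>The covariance matrix of a nominal orbit is only meaningful if the normal matrix is invertible.\<close>

definition nominal_orbit :: "(orbit \<Rightarrow> real^'m) \<Rightarrow> orbit \<Rightarrow> bool" where
  "nominal_orbit F x \<longleftrightarrow>
     local_minimiser_on orbits (target F) x \<and> invertible (normal_matrix F x)"


section \<open>The manifold of variations\<close>

text \<open>
  The doubly constrained differential corrections are an iteration on attributables with \<open>\<rho>\<close> fixed:
  \<open>step \<rho>\<close> is one correction and \<open>init \<rho>\<close> the first guess. Both are left arbitrary.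
\<close>

definition dc_iterate ::
    "(real^2 \<Rightarrow> attributable \<Rightarrow> attributable) \<Rightarrow> (real^2 \<Rightarrow> attributable) \<Rightarrow> real^2 \<Rightarrow> nat \<Rightarrow> attributable"
  where "dc_iterate step init \<rho> n = (step \<rho> ^^ n) (init \<rho>)"

definition dc_solution ::
    "(real^2 \<Rightarrow> attributable \<Rightarrow> attributable) \<Rightarrow> (real^2 \<Rightarrow> attributable) \<Rightarrow> real^2 \<Rightarrow> attributable"
  where "dc_solution step init \<rho> = lim (dc_iterate step init \<rho>)"

definition dc_domain ::
    "(orbit \<Rightarrow> real^'m) \<Rightarrow> (real^2 \<Rightarrow> attributable \<Rightarrow> attributable) \<Rightarrow> (real^2 \<Rightarrow> attributable)
      \<Rightarrow> (real^2) set \<Rightarrow> (real^2) set"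
  where "dc_domain F step init K =
    {\<rho> \<in> K. convergent (dc_iterate step init \<rho>) \<and>
       local_minimiser_on attributables (\<lambda>a. target F (a, \<rho>)) (dc_solution step init \<rho>)}"

definition mov_param :: "(real^2 \<Rightarrow> attributable) \<Rightarrow> real^2 \<Rightarrow> orbit" where
  "mov_param A \<rho> = (A \<rho>, \<rho>)"

text \<open>
  \<open>J\<close> is the \<open>4 \<times> 2\<close> Jacobian matrix of \<open>A\<close> at \<open>\<rho>\<close> within \<open>T\<close> in the coordinates of the attributables:
  it is the derivative of a map \<open>c\<close> expressing \<open>A\<close> in coordinates near \<open>\<rho>\<close>. No coordinate expression
  of \<open>A\<close> on the whole of \<open>T\<close> is required, as it need not exist.
\<close>

definition has_attr_jacobian ::
    "(real^2 \<Rightarrow> attributable) \<Rightarrow> real^2^4 \<Rightarrow> real^2 \<Rightarrow> (real^2) set \<Rightarrow> bool"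
  where "has_attr_jacobian A J \<rho> T \<longleftrightarrow>
    (\<exists>c e. 0 < e \<and> (\<forall>\<rho>'\<in>T \<inter> ball \<rho> e. attr_of_coords (c \<rho>') = A \<rho>') \<and>
           (c has_derivative (\<lambda>h. J *v h)) (at \<rho> within T))"

definition gram_mu :: "(real^2 \<Rightarrow> real^2^4) \<Rightarrow> real^2 \<Rightarrow> real" where
  "gram_mu DA \<rho> = det (mat 1 + transpose (DA \<rho>) ** DA \<rho>)"

text \<open>
  The minimum of the target function on the manifold, as an infimum. That it is attained is a
  separate hypothesis.
\<close>

definition target_min :: "(orbit \<Rightarrow> real^'m) \<Rightarrow> orbit set \<Rightarrow> real" where
  "target_min F M = (INF x\<in>M. target F x)"

definition chi :: "(orbit \<Rightarrow> real^'m) \<Rightarrow> orbit set \<Rightarrow> orbit \<Rightarrow> real" where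
  "chi F M x = sqrt (real CARD('m) * (target F x - target_min F M))"


section \<open>Surface measure\<close>

text \<open>
  The two-dimensional Hausdorff measure, normalised so as to agree with the area of plane sets.
  \<open>bounded\<close> is needed because \<open>diameter\<close> is a junk value on unbounded sets.
\<close>

definition hausdorff2_pre :: "real \<Rightarrow> 'a::metric_space set \<Rightarrow> ennreal" where
  "hausdorff2_pre \<delta> E =
     (INF U \<in> {U :: nat \<Rightarrow> 'a set. E \<subseteq> (\<Union>i. U i) \<and> (\<forall>i. bounded (U i) \<and> diameter (U i) \<le> \<delta>)}.
        \<Sum>i. ennreal (pi * (diameter (U i) / 2)\<^sup>2))"

definition hausdorff2 :: "'a::metric_space set \<Rightarrow> ennreal" where
  "hausdorff2 E = (SUP \<delta>\<in>{0<..}. hausdorff2_pre \<delta> E)"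

definition surface_measure :: "'a::metric_space set \<Rightarrow> 'a measure" where
  "surface_measure M = restrict_space (measure_of UNIV (sets borel) hausdorff2) M"


section \<open>Sampling\<close>

text \<open>
  The arguments of \<open>Cobweb\<close> are the nominal orbit, the two eigenvalues of its range covariance, and
  the unit eigenvector of the first one.
\<close>

datatype sampling = Uniform_range | Uniform_log_range | Cobweb orbit real real "real^2"

fun valid_sampling :: "(orbit \<Rightarrow> real^'m) \<Rightarrow> sampling \<Rightarrow> bool" where
  "valid_sampling F Uniform_range \<longleftrightarrow> True"
| "valid_sampling F Uniform_log_range \<longleftrightarrow> True"
| "valid_sampling F (Cobweb x l1 l2 v1) \<longleftrightarrow>
     nominal_orbit F x \<and> l1 > l2 \<and> l2 > 0 \<and>
     norm v1 = 1 \<and> range_covariance F x *v v1 = l1 *\<^sub>R v1 \<and>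
     (\<exists>v2. v2 \<noteq> 0 \<and> range_covariance F x *v v2 = l2 *\<^sub>R v2)"

text \<open>
  The circle factor of the cobweb sampling space is the interval of angles \<open>[0, 2 * pi)\<close>, on which its
  measure is Lebesgue measure.
\<close>

fun sampling_space :: "sampling \<Rightarrow> (real^2) set" where
  "sampling_space Uniform_range = {s. 0 \<le> s $ 1}"
| "sampling_space Uniform_log_range = UNIV"
| "sampling_space (Cobweb x l1 l2 v1) = {s. 0 \<le> s $ 1 \<and> 0 \<le> s $ 2 \<and> s $ 2 < 2 * pi}"

fun f_sigma :: "sampling \<Rightarrow> real^2 \<Rightarrow> real^2" where
  "f_sigma Uniform_range s = s"
| "f_sigma Uniform_log_range s = vector [10 powr (s $ 1), s $ 2]"
| "f_sigma (Cobweb x l1 l2 v1) s =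
     (s $ 1) *\<^sub>R
       ((vector [vector [sqrt l1 * cos (s $ 2), - (sqrt l2 * sin (s $ 2))],
                 vector [sqrt l2 * sin (s $ 2), sqrt l1 * cos (s $ 2)]] :: real^2^2) *v v1)
     + snd x"

definition gram_sigma :: "sampling \<Rightarrow> real^2 \<Rightarrow> real" where
  "gram_sigma t s =
     (let J = jacobian (f_sigma t) (at s) in det (transpose J ** J))"

end

theory Submission
  imports Defs
begin

text \<open>
  The law of the sample is the pull-back of the law on the manifold along \<open>mov_param Astar \<circ> f_sigma t\<close>,
  so everything rests on an area formula for the two-dimensional Hausdorff measure. On the plane this
  measure is translation invariant and locally finite, hence \<open>C\<close> times Lebesgue measure, and
  a map whose derivative satisfies \<open>|f' x h| = |T x h|\<close> for a \<open>2 \<times> 2\<close> matrix \<open>T x\<close> is, on countably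
  many Borel pieces, arbitrarily close to the linear map \<open>T q\<close> in the bi-Lipschitz sense, so that
  areas are multiplied by \<open>C * |det (T x)|\<close>. For the manifold of variations \<open>T\<close> is a triangular square root of
  \<open>I + DA\<^sup>T DA\<close> times the Jacobian of \<open>f_sigma\<close>. The constant \<open>C\<close> and the unknown constant of
  the density cancel because the total mass is 1.
\<close>

section \<open>Two-dimensional Hausdorff measure\<close>

text \<open>\<open>K'\<close> is merely Borel and derivatives are taken within it, so no chart on an
  open set is at hand: the comparison of \<open>f\<close> with \<open>T q\<close> is made between
  points of \<open>S\<close> alone, and the sets where it holds with a given radius are relatively
  closed in \<open>S\<close>, hence Borel. It costs a factor \<open>t^2\<close> for the Lipschitz
  constants and \<open>t\<close> for the determinant, and \<open>t > 1\<close> is arbitrary.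
  Additivity of the Hausdorff measure is obtained on the space of orbits; it reaches the plane
  through an isometric slice. The other obstacle is the sampling map. Cobweb sampling collapses
  \<open>r = 0\<close> to one point, and a null subset of the sampling space cannot simply be
  discarded for \<open>S\<close>, whose law is still unknown. The exclusion goes through
  \<open>X\<close>: \<open>f_sigma\<close> maps the boundary to a null set of the plane, the area
  formula with the identity in place of the sampling map makes the part of the manifold above it
  null, and \<open>X\<close>, having a density, avoids it almost surely.\<close>

lemma diameter_le_dist:
  fixes S :: "'a::metric_space set"
  assumes "0 \<le> d" "\<And>x y. x \<in> S \<Longrightarrow> y \<in> S \<Longrightarrow> dist x y \<le> d"
  shows "diameter S \<le> d"
  using assms by (auto simp: diameter_def intro!: cSUP_least)

text \<open>Two maps on a common set replace one map between the images: no injectivity is involved,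
  and exchanging \<open>f\<close> and \<open>g\<close> gives the reverse bound. A cover of the image
  under \<open>g\<close> is pulled back to \<open>E\<close> and pushed forward by \<open>f\<close>;
  diameters grow at most by \<open>L\<close>, areas by its square.\<close>

lemma hausdorff2_pre_image_le:
  fixes f :: "'c \<Rightarrow> 'a::metric_space" and g :: "'c \<Rightarrow> 'b::metric_space"
  assumes L: "0 < L" and lip: "\<And>x y. x \<in> E \<Longrightarrow> y \<in> E \<Longrightarrow> dist (f x) (f y) \<le> L * dist (g x) (g y)"
  shows "hausdorff2_pre (L * \<delta>) (f ` E) \<le> ennreal (L\<^sup>2) * hausdorff2_pre \<delta> (g ` E)"
proof -
  have *: "hausdorff2_pre (L * \<delta>) (f ` E) \<le> ennreal (L\<^sup>2) * (\<Sum>i. ennreal (pi * (diameter (U i) / 2)\<^sup>2))"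
    if cov: "g ` E \<subseteq> (\<Union>i. U i)" and U: "\<And>i. bounded (U i) \<and> diameter (U i) \<le> \<delta>" for U :: "nat \<Rightarrow> 'b set"
  proof -
    define V where "V i = f ` (E \<inter> g -` U i)" for i
    have lipV: "dist a b \<le> L * diameter (U i)" if ab: "a \<in> V i" "b \<in> V i" for a b i
    proof -
      obtain x y where xy: "x \<in> E" "y \<in> E" "g x \<in> U i" "g y \<in> U i" "a = f x" "b = f y"
        using ab by (auto simp: V_def)
      have "dist a b \<le> L * dist (g x) (g y)" using lip xy by simp
      also have "\<dots> \<le> L * diameter (U i)"
        using L U xy by (intro mult_left_mono diameter_bounded_bound) auto
      finally show ?thesis .
    qed
    have dV: "diameter (V i) \<le> L * diameter (U i)" for i
      using L U diameter_ge_0 by (intro diameter_le_dist lipV mult_nonneg_nonneg) auto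
    have bV: "bounded (V i)" for i
      unfolding bounded_two_points using lipV by blast
    have "hausdorff2_pre (L * \<delta>) (f ` E) \<le> (\<Sum>i. ennreal (pi * (diameter (V i) / 2)\<^sup>2))"
      unfolding hausdorff2_pre_def
    proof (rule INF_lower, safe)
      show "f x \<in> (\<Union>i. V i)" if "x \<in> E" for x
        using imageI[OF that, of g] cov that unfolding V_def by blast
      show "diameter (V i) \<le> L * \<delta>" for i
        using dV[of i] U[of i] L mult_left_mono[of "diameter (U i)" \<delta> L] by linarith
    qed (rule bV)
    also have "\<dots> \<le> (\<Sum>i. ennreal (L\<^sup>2) * ennreal (pi * (diameter (U i) / 2)\<^sup>2))"
    proof (intro suminf_le summableI)
      fix i
      have "pi * (diameter (V i) / 2)\<^sup>2 \<le> pi * ((L * diameter (U i)) / 2)\<^sup>2"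
        using dV[of i] bV[of i] by (intro mult_left_mono power_mono divide_right_mono) (auto simp: diameter_ge_0)
      also have "\<dots> = L\<^sup>2 * (pi * (diameter (U i) / 2)\<^sup>2)"
        by (simp add: power_mult_distrib power_divide)
      finally show "ennreal (pi * (diameter (V i) / 2)\<^sup>2) \<le> ennreal (L\<^sup>2) * ennreal (pi * (diameter (U i) / 2)\<^sup>2)"
        by (simp add: ennreal_mult[symmetric])
    qed
    finally show ?thesis by simp
  qed
  \<comment> \<open>Dividing leaves the bare infimum on the right, where it can be bounded cover by
    cover.\<close>
  have "hausdorff2_pre (L * \<delta>) (f ` E) / ennreal (L\<^sup>2) \<le> hausdorff2_pre \<delta> (g ` E)"
    unfolding hausdorff2_pre_def[of \<delta>]
  proof (rule INF_greatest)
    fix U :: "nat \<Rightarrow> 'b set" assume "U \<in> {U. g ` E \<subseteq> \<Union> (range U) \<and> (\<forall>i. bounded (U i) \<and> diameter (U i) \<le> \<delta>)}"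
    then have "hausdorff2_pre (L * \<delta>) (f ` E) \<le> ennreal (L\<^sup>2) * (\<Sum>i. ennreal (pi * (diameter (U i) / 2)\<^sup>2))"
      by (intro *) auto
    then show "hausdorff2_pre (L * \<delta>) (f ` E) / ennreal (L\<^sup>2) \<le> (\<Sum>i. ennreal (pi * (diameter (U i) / 2)\<^sup>2))"
      using L by (intro divide_le_posI_ennreal) (auto simp: mult.commute)
  qed
  then have "hausdorff2_pre (L * \<delta>) (f ` E) / ennreal (L\<^sup>2) * ennreal (L\<^sup>2) \<le> hausdorff2_pre \<delta> (g ` E) * ennreal (L\<^sup>2)"
    by (rule mult_right_mono) simp
  moreover have "hausdorff2_pre (L * \<delta>) (f ` E) / ennreal (L\<^sup>2) * ennreal (L\<^sup>2) = hausdorff2_pre (L * \<delta>) (f ` E)"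
    using L by (simp add: ennreal_divide_times ennreal_divide_self)
  ultimately show ?thesis by (simp add: mult.commute)
qed

lemma hausdorff2_image_le:
  fixes f :: "'c \<Rightarrow> 'a::metric_space" and g :: "'c \<Rightarrow> 'b::metric_space"
  assumes L: "0 < L" and lip: "\<And>x y. x \<in> E \<Longrightarrow> y \<in> E \<Longrightarrow> dist (f x) (f y) \<le> L * dist (g x) (g y)"
  shows "hausdorff2 (f ` E) \<le> ennreal (L\<^sup>2) * hausdorff2 (g ` E)"
  unfolding hausdorff2_def[of "f ` E"]
proof (rule SUP_least)
  fix \<delta> :: real assume "\<delta> \<in> {0<..}"
  then have "hausdorff2_pre (L * (\<delta> / L)) (f ` E) \<le> ennreal (L\<^sup>2) * hausdorff2_pre (\<delta> / L) (g ` E)"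
    by (intro hausdorff2_pre_image_le assms)
  also have "\<dots> \<le> ennreal (L\<^sup>2) * hausdorff2 (g ` E)"
    using \<open>\<delta> \<in> {0<..}\<close> L by (intro mult_left_mono) (auto simp: hausdorff2_def intro!: SUP_upper)
  finally show "hausdorff2_pre \<delta> (f ` E) \<le> ennreal (L\<^sup>2) * hausdorff2 (g ` E)"
    using L by simp
qed

lemma hausdorff2_isometric_image:
  fixes f :: "'b::metric_space \<Rightarrow> 'a::metric_space"
  assumes "\<And>x y. x \<in> E \<Longrightarrow> y \<in> E \<Longrightarrow> dist (f x) (f y) = dist x y"
  shows "hausdorff2 (f ` E) = hausdorff2 E"
  using hausdorff2_image_le[of 1 E f "\<lambda>x. x"] hausdorff2_image_le[of 1 E "\<lambda>x. x" f] assms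
  by (intro antisym) auto

lemma hausdorff2_mono: "A \<subseteq> B \<Longrightarrow> hausdorff2 A \<le> hausdorff2 B"
  unfolding hausdorff2_def hausdorff2_pre_def
  by (intro SUP_mono' INF_superset_mono) auto

text \<open>In a grid of \<open>n * n\<close> half-open cells of side \<open>1 / n\<close>, the sum
  of the coordinate differences bounds each diameter by \<open>2 / n\<close>, so the areas add up to
  at most \<open>pi\<close> for every \<open>n\<close>. Only finiteness matters later.\<close>

lemma hausdorff2_pre_unit_square:
  assumes "0 < \<delta>"
  shows "hausdorff2_pre \<delta> {x :: real^2. \<forall>i. 0 \<le> x $ i \<and> x $ i < 1} \<le> ennreal pi"
proof -
  obtain n :: nat where n: "2 / \<delta> < real n" using reals_Archimedean2 by blast
  with assms have n0: "0 < n" by (cases n) (auto simp: field_simps)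
  have n\<delta>: "2 / real n \<le> \<delta>" using n n0 assms by (simp add: field_simps)
  \<comment> \<open>Cells are numbered row by row, with \<open>k mod n\<close> the position along
    the first coordinate; the sets from \<open>n * n\<close> on are empty and contribute 0 to the
    series.\<close>
  define U :: "nat \<Rightarrow> (real^2) set" where "U k = (if k < n * n then
      {x. real (k mod n) \<le> n * x $ 1 \<and> n * x $ 1 < k mod n + 1 \<and>
          real (k div n) \<le> n * x $ 2 \<and> n * x $ 2 < k div n + 1} else {})" for k
  have near: "dist x y \<le> 2 / real n" if "x \<in> U k" "y \<in> U k" for x y k
  proof -
    have xy: "\<bar>real n * x $ i - real n * y $ i\<bar> \<le> 1" for i
      using that exhaust_2[of i] by (auto simp: U_def split: if_splits)
    have xy': "\<bar>(x - y) $ i\<bar> \<le> 1 / n" for i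
      using xy[of i] n0 by (simp add: abs_le_iff field_simps)
    have "dist x y \<le> (\<Sum>i\<in>UNIV. \<bar>(x - y) $ i\<bar>)"
      by (simp only: dist_norm norm_le_l1_cart)
    also have "\<dots> \<le> 2 / n" using xy'[of 1] xy'[of 2] by (simp add: sum_2)
    finally show ?thesis .
  qed
  have bU: "bounded (U k)" for k
    unfolding bounded_two_points using near by blast
  have dU: "diameter (U k) \<le> 2 / n" for k
    by (intro diameter_le_dist near) auto
  have "hausdorff2_pre \<delta> {x :: real^2. \<forall>i. 0 \<le> x $ i \<and> x $ i < 1} \<le> (\<Sum>k. ennreal (pi * (diameter (U k) / 2)\<^sup>2))"
    unfolding hausdorff2_pre_def
  proof (rule INF_lower, safe)
    fix x :: "real^2" assume x: "\<forall>i. 0 \<le> x $ i \<and> x $ i < 1"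
    define a where "a i = nat \<lfloor>n * x $ i\<rfloor>" for i
    have a: "real (a i) \<le> n * x $ i" "n * x $ i < a i + 1" for i
      using x floor_correct[of "real n * x $ i"] by (simp_all add: a_def algebra_simps)
    have an: "a i < n" for i
    proof -
      have "real (a i) \<le> n * x $ i" by (rule a)
      also have "\<dots> < real n" using x n0 by simp
      finally show ?thesis by simp
    qed
    have "n * a 2 + a 1 < n * n"
    proof -
      have "n * a 2 + a 1 < n * (a 2 + 1)" using an[of 1] by simp
      also have "\<dots> \<le> n * n" using an[of 2] by (intro mult_le_mono2) simp
      finally show ?thesis .
    qed
    moreover have "(n * a 2 + a 1) mod n = a 1" "(n * a 2 + a 1) div n = a 2" using an[of 1] by auto
    ultimately have "x \<in> U (n * a 2 + a 1)" using a[of 1] a[of 2] by (simp add: U_def)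
    then show "x \<in> (\<Union>k. U k)" by blast
  next
    show "diameter (U k) \<le> \<delta>" for k using dU[of k] n\<delta> by linarith
  qed (rule bU)
  also have "\<dots> = (\<Sum>k<n*n. ennreal (pi * (diameter (U k) / 2)\<^sup>2))"
    by (rule suminf_finite) (auto simp: U_def)
  also have "\<dots> \<le> (\<Sum>k<n*n. ennreal (pi * ((2 / n) / 2)\<^sup>2))"
    using dU bU by (intro sum_mono ennreal_leI mult_left_mono power_mono divide_right_mono) (auto simp: diameter_ge_0)
  also have "\<dots> = ennreal (real (n * n) * (pi * ((2 / n) / 2)\<^sup>2))"
    by (simp add: ennreal_of_nat_eq_real_of_nat ennreal_mult[symmetric] del: of_nat_mult)
  also have "real (n * n) * (pi * ((2 / n) / 2)\<^sup>2) = pi"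
    using n0 by (simp add: power2_eq_square)
  finally show ?thesis .
qed

lemma hausdorff2_square_finite:
  "hausdorff2 {x :: real^2. \<forall>i. - real n \<le> x $ i \<and> x $ i < real n} < \<infinity>"
\<comment> \<open>The affine map used for \<open>n > 0\<close> has Lipschitz constant
  \<open>2 * n\<close>, which the scaling bound needs to be positive.\<close>
proof (cases "n = 0")
  case True
  have empty: "{x :: real^2. \<forall>i. - real n \<le> x $ i \<and> x $ i < real n} = {}"
    using True by auto
  have "hausdorff2 ({} :: (real^2) set) \<le> hausdorff2 {x :: real^2. \<forall>i. 0 \<le> x $ i \<and> x $ i < 1}"
    by (rule hausdorff2_mono) simp
  also have "\<dots> \<le> ennreal pi"
    unfolding hausdorff2_def by (intro SUP_least hausdorff2_pre_unit_square) simp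
  finally show ?thesis unfolding empty by (auto simp: less_top[symmetric] top_unique)
next
  case False
  define Q where "Q = {x :: real^2. \<forall>i. 0 \<le> x $ i \<and> x $ i < 1}"
  define f where "f x = (2 * real n) *\<^sub>R x - (\<chi> i. real n)" for x :: "real^2"
  have "{x :: real^2. \<forall>i. - real n \<le> x $ i \<and> x $ i < real n} \<subseteq> f ` Q"
  proof
    fix x :: "real^2" assume x: "x \<in> {x. \<forall>i. - real n \<le> x $ i \<and> x $ i < real n}"
    define y where "y = (1 / (2 * real n)) *\<^sub>R (x + (\<chi> i. real n))"
    have "f y = x" using False by (simp add: f_def y_def)
    moreover have "y \<in> Q" unfolding Q_def
    proof safe
      fix i
      have "- real n \<le> x $ i" "x $ i < real n" using x by auto
      then show "0 \<le> y $ i" "y $ i < 1" using False by (auto simp: y_def field_simps)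
    qed
    ultimately show "x \<in> f ` Q" by blast
  qed
  then have "hausdorff2 {x :: real^2. \<forall>i. - real n \<le> x $ i \<and> x $ i < real n} \<le> hausdorff2 (f ` Q)"
    by (rule hausdorff2_mono)
  also have "\<dots> \<le> ennreal ((2 * real n)\<^sup>2) * hausdorff2 ((\<lambda>x. x) ` Q)"
    using False by (intro hausdorff2_image_le) (auto simp: f_def dist_norm scaleR_diff_right[symmetric])
  also have "\<dots> \<le> ennreal ((2 * real n)\<^sup>2) * ennreal pi"
    unfolding hausdorff2_def Q_def image_ident by (intro mult_left_mono SUP_least hausdorff2_pre_unit_square) auto
  also have "\<dots> < \<infinity>" by (simp add: ennreal_mult_less_top)
  finally show ?thesis .
qed

text \<open>The uniqueness argument for Haar measure: the double integral of
  \<open>indicator E x * indicator ?Q (y - x)\<close> is evaluated in both orders, using invariance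
  of \<open>lborel\<close> in \<open>y\<close> and of \<open>M\<close> in \<open>x\<close>.
  Sigma-finiteness permits the exchange.\<close>

lemma emeasure_translation_invariant:
  fixes M :: "'a::euclidean_space measure"
  assumes "sigma_finite_measure M" and sets: "sets M = sets borel"
    and inv: "\<And>a E. E \<in> sets borel \<Longrightarrow> emeasure M ((\<lambda>x. a + x) -` E) = emeasure M E"
    and E: "E \<in> sets borel"
  shows "emeasure M E = emeasure M (box (- One) 0) * emeasure lborel E"
proof -
  interpret M: sigma_finite_measure M by fact
  interpret pair_sigma_finite M "lborel :: 'a measure" ..
  let ?Q = "box 0 One :: 'a set"
  have [measurable_cong]: "sets M = sets borel" by (rule sets)
  note E[measurable]
  have Q1: "emeasure lborel ?Q = 1" by (simp add: emeasure_lborel_box_eq)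
  have inv': "(\<integral>\<^sup>+x. f (a + x) \<partial>M) = (\<integral>\<^sup>+x. f x \<partial>M)" if f: "f \<in> borel_measurable borel" for f and a :: 'a
  proof -
    have "distr M borel (\<lambda>x. a + x) = M"
    proof (rule measure_eqI)
      fix A assume A: "A \<in> sets (distr M borel ((+) a))"
      have "space M = UNIV" using sets sets_eq_imp_space_eq by fastforce
      then show "emeasure (distr M borel ((+) a)) A = emeasure M A"
        using A inv by (subst emeasure_distr) auto
    qed (simp add: sets)
    then have "(\<integral>\<^sup>+x. f x \<partial>M) = (\<integral>\<^sup>+x. f x \<partial>distr M borel (\<lambda>x. a + x))" by simp
    also have "\<dots> = (\<integral>\<^sup>+x. f (a + x) \<partial>M)"
      using f by (intro nn_integral_distr) simp_all
    finally show ?thesis by simp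
  qed
  have linv: "(\<integral>\<^sup>+x. f (a + x) \<partial>lborel) = (\<integral>\<^sup>+x. f x \<partial>lborel)" if f: "f \<in> borel_measurable borel" for f and a :: 'a
  proof -
    have "(\<integral>\<^sup>+x. f x \<partial>lborel) = (\<integral>\<^sup>+x. f x \<partial>distr lborel borel (\<lambda>x. a + x))"
      using lborel_distr_plus[of a] by simp
    also have "\<dots> = (\<integral>\<^sup>+x. f (a + x) \<partial>lborel)"
      using f by (intro nn_integral_distr) simp_all
    finally show ?thesis by simp
  qed
  have "emeasure M E = (\<integral>\<^sup>+x. indicator E x * (\<integral>\<^sup>+y. indicator ?Q y \<partial>lborel) \<partial>M)"
    by (simp add: Q1)
  also have "\<dots> = (\<integral>\<^sup>+x. indicator E x * (\<integral>\<^sup>+y. indicator ?Q (- x + y) \<partial>lborel) \<partial>M)"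
    by (subst linv) auto
  also have "\<dots> = (\<integral>\<^sup>+x. (\<integral>\<^sup>+y. indicator E x * indicator ?Q (- x + y) \<partial>lborel) \<partial>M)"
    by (subst nn_integral_cmult) auto
  also have "\<dots> = (\<integral>\<^sup>+y. (\<integral>\<^sup>+x. indicator E x * indicator ?Q (- x + y) \<partial>M) \<partial>lborel)"
    by (rule Fubini'[symmetric]) measurable
  \<comment> \<open>Shifting \<open>x\<close> by \<open>y\<close> frees the second factor from
    \<open>y\<close>; it then only sees the reflected box \<open>box (- One) 0\<close>, the origin
    of the constant.\<close>
  also have "\<dots> = (\<integral>\<^sup>+y. (\<integral>\<^sup>+x. indicator E (y + x) * indicator ?Q (- (y + x) + y) \<partial>M) \<partial>lborel)"
    by (subst inv') auto
  also have "\<dots> = (\<integral>\<^sup>+y. (\<integral>\<^sup>+x. indicator E (y + x) * indicator ?Q (- x) \<partial>M) \<partial>lborel)"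
    by simp
  also have "\<dots> = (\<integral>\<^sup>+x. (\<integral>\<^sup>+y. indicator E (y + x) * indicator ?Q (- x) \<partial>lborel) \<partial>M)"
    by (rule Fubini') measurable
  also have "\<dots> = (\<integral>\<^sup>+x. (\<integral>\<^sup>+y. indicator E (x + y) \<partial>lborel) * indicator ?Q (- x) \<partial>M)"
    by (subst nn_integral_multc) (auto simp: add.commute)
  also have "\<dots> = (\<integral>\<^sup>+x. emeasure lborel E * indicator (box (- One) 0) x \<partial>M)"
    by (subst linv) (auto intro!: nn_integral_cong simp: indicator_def mem_box)
  also have "\<dots> = emeasure M (box (- One) 0) * emeasure lborel E"
    by (simp add: nn_integral_cmult mult.commute)
  finally show ?thesis .
qed

text \<open>
  The normalisation of the Hausdorff measure is irrelevant, since it cancels in a probability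
  density; hence the isodiametric inequality is not needed to identify the constant \<open>C\<close>.
\<close>

lemma hausdorff2_eq_lborel:
  fixes \<nu> :: "(real^2) measure"
  assumes sets: "sets \<nu> = sets borel" and \<nu>: "\<And>B. B \<in> sets borel \<Longrightarrow> emeasure \<nu> B = hausdorff2 B"
  obtains C where "C < \<infinity>" "\<And>E :: (real^2) set. E \<in> sets borel \<Longrightarrow> hausdorff2 E = C * emeasure lborel E"
proof -
  let ?A = "\<lambda>n::nat. {x :: real^2. \<forall>i. - real n \<le> x $ i \<and> x $ i < real n}"
  have A: "?A n \<in> sets borel" for n by measurable
  have bdd: "\<exists>n. x \<in> ?A n" for x :: "real^2"
  proof -
    obtain n :: nat where "\<bar>x $ 1\<bar> + \<bar>x $ 2\<bar> < n" using reals_Archimedean2 by blast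
    then have "- real n \<le> x $ i \<and> x $ i < real n" for i using exhaust_2[of i] by auto
    then show ?thesis by auto
  qed
  have "space \<nu> = UNIV" using sets sets_eq_imp_space_eq by fastforce
  have "sigma_finite_measure \<nu>"
  proof
    show "\<exists>A. countable A \<and> A \<subseteq> sets \<nu> \<and> \<Union> A = space \<nu> \<and> (\<forall>a\<in>A. emeasure \<nu> a \<noteq> \<infinity>)"
      using A bdd hausdorff2_square_finite \<open>space \<nu> = UNIV\<close>
      by (intro exI[of _ "range ?A"]) (auto simp: sets \<nu> less_top[symmetric] simp del: all_simps)
  qed
  moreover have "emeasure \<nu> ((\<lambda>x. a + x) -` E) = emeasure \<nu> E" if E: "E \<in> sets borel" for a and E :: "(real^2) set"
  proof -
    have "(\<lambda>x. a + x) -` E = (\<lambda>x. - a + x) ` E" by force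
    moreover have "(\<lambda>x. a + x) -` E \<in> sets borel"
      using measurable_sets[of "\<lambda>x. a + x" borel borel E] E by simp
    ultimately show ?thesis using E \<nu> hausdorff2_isometric_image[of E "\<lambda>x. - a + x"]
      by (simp add: \<nu> dist_norm)
  qed
  ultimately have "emeasure \<nu> E = emeasure \<nu> (box (- One) 0) * emeasure lborel E" if "E \<in> sets borel" for E
    using sets that by (intro emeasure_translation_invariant)
  \<comment> \<open>This measure is the constant \<open>C\<close>; the open box lies in the square
    for \<open>n = 1\<close>.\<close>
  moreover have "emeasure \<nu> (box (- One) 0) < \<infinity>"
  proof -
    have "(box (- One) 0 :: (real^2) set) \<subseteq> ?A 1"
    proof safe
      fix x :: "real^2" and i :: 2 assume x: "x \<in> box (- One) 0"
      have "- (One \<bullet> axis i (1::real)) < x \<bullet> axis i 1 \<and> x \<bullet> axis i 1 < 0"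
        using x by (simp only: mem_box inner_minus_left inner_zero_left axis_in_Basis_iff Basis_real_def)
          (auto simp: axis_in_Basis_iff)
      moreover have "One \<bullet> axis i (1::real) = 1"
        by (simp add: inner_sum_left inner_Basis)
      ultimately show "- real 1 \<le> x $ i" "x $ i < real 1" by (simp_all add: inner_axis)
    qed
    then show ?thesis
      using \<nu> hausdorff2_mono[of "box (- One) 0" "?A 1"] hausdorff2_square_finite[of 1]
      by (auto intro: le_less_trans)
  qed
  ultimately show ?thesis using that \<nu> by metis
qed

text \<open>
  \<^const>\<open>measure_of\<close> yields the zero measure when its set function is not countably additive, so the
  existence of a density with respect to the surface measure already implies additivity on Borel
  sets; Caratheodory's construction is not needed.
\<close>

lemma hausdorff2_measure_space:
  fixes X :: "'w \<Rightarrow> 'b::metric_space"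
  assumes "prob_space P" and X: "distributed P (surface_measure M) X p"
  shows "measure_space UNIV (sets borel) (hausdorff2 :: 'b set \<Rightarrow> ennreal)"
proof (rule ccontr)
  assume neg: "\<not> ?thesis"
  interpret prob_space P by fact
  have sig: "sigma_sets UNIV (sets (borel :: 'b measure)) = sets borel"
    using sets.sigma_sets_eq[of "borel :: 'b measure"] by simp
  have "emeasure (surface_measure M) A = 0" for A
    using neg by (simp add: surface_measure_def restrict_space_def emeasure_measure_of_conv sig)
  then show False using distributed_imp_emeasure_nonzero[OF X] by simp
qed

lemma emeasure_hausdorff2_measure_of:
  assumes "measure_space UNIV (sets borel) (hausdorff2 :: 'b::metric_space set \<Rightarrow> ennreal)"
  shows "sets (measure_of UNIV (sets borel) (hausdorff2 :: 'b set \<Rightarrow> ennreal)) = sets borel"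
    and "B \<in> sets borel \<Longrightarrow> emeasure (measure_of UNIV (sets borel) hausdorff2) B = hausdorff2 (B :: 'b set)"
  using assms sets.sigma_sets_eq[of "borel :: 'b measure"]
  by (simp_all add: emeasure_measure_of_conv)

text \<open>The closed slice \<open>{0} \<times> UNIV\<close> is an isometric copy of the plane.
  Restricting the measure to it and projecting by \<open>snd\<close> yields a Borel measure on the
  plane that coincides with \<open>hausdorff2\<close> there.\<close>

lemma hausdorff2_eq_lborel_prod:
  assumes "measure_space UNIV (sets borel) (hausdorff2 :: ('a::euclidean_space \<times> (real^2)) set \<Rightarrow> ennreal)"
  obtains C where "C < \<infinity>" "\<And>E :: (real^2) set. E \<in> sets borel \<Longrightarrow> hausdorff2 E = C * emeasure lborel E"
proof -
  let ?\<nu> = "measure_of UNIV (sets borel) hausdorff2 :: ('a \<times> (real^2)) measure"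
  let ?Z = "{0} \<times> UNIV :: ('a \<times> (real^2)) set"
  note \<nu> = emeasure_hausdorff2_measure_of[OF assms]
  have space: "space ?\<nu> = UNIV" by simp
  have Z: "?Z \<in> sets borel" by (intro borel_closed closed_Times) auto
  have snd: "snd \<in> restrict_space ?\<nu> ?Z \<rightarrow>\<^sub>M borel"
    using sets_restrict_space_cong[OF \<nu>(1), of ?Z]
    by (subst measurable_cong_sets) (auto intro!: measurable_restrict_space1 borel_measurable_continuous_onI continuous_intros)
  have "emeasure (distr (restrict_space ?\<nu> ?Z) borel snd) B = hausdorff2 B" if B: "B \<in> sets borel" for B
  proof -
    have im: "snd -` B \<inter> ?Z = Pair 0 ` B" by auto
    have "snd -` B \<inter> ?Z \<in> sets borel"
      using measurable_sets[OF snd B] Z by (simp add: space_restrict_space sets_restrict_space_iff \<nu>(1))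
    then have "emeasure (distr (restrict_space ?\<nu> ?Z) borel snd) B = hausdorff2 (snd -` B \<inter> ?Z)"
      using snd B Z by (simp add: emeasure_distr space_restrict_space emeasure_restrict_space \<nu>)
    also have "\<dots> = hausdorff2 B"
      unfolding im by (rule hausdorff2_isometric_image) (simp add: dist_Pair_Pair)
    finally show ?thesis .
  qed
  then show ?thesis
    by (rule hausdorff2_eq_lborel[rotated]) (auto intro: that)
qed

section \<open>The area formula\<close>

text \<open>The norm of a matrix is here the Frobenius norm, so Cauchy-Schwarz in each row
  suffices.\<close>

lemma norm_matrix_vector_mult_le: "norm (A *v x) \<le> norm A * norm (x :: real^'n)" for A :: "real^'n^'m"
proof -
  have "norm (A *v x) = L2_set (\<lambda>i. \<bar>A $ i \<bullet> x\<bar>) UNIV"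
    by (simp add: norm_vec_def matrix_vector_mul_component)
  also have "\<dots> \<le> L2_set (\<lambda>i. norm (A $ i) * norm x) UNIV"
    by (intro L2_set_mono Cauchy_Schwarz_ineq2) auto
  also have "\<dots> = norm A * norm x"
    by (simp add: norm_vec_def L2_set_left_distrib)
  finally show ?thesis .
qed

lemma continuous_on_det_2:
  fixes T :: "'a::topological_space \<Rightarrow> real^2^2"
  shows "continuous_on S T \<Longrightarrow> continuous_on S (\<lambda>x. det (T x))"
  unfolding det_2 by (intro continuous_intros)

text \<open>The exponent 3 is the total error of the area formula: two factors from the Lipschitz
  constant, one from the determinant.\<close>

lemma ennreal_le_mult_gt_1:
  fixes x y :: ennreal
  assumes "\<And>t::real. 1 < t \<Longrightarrow> x \<le> ennreal (t ^ 3) * y"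
  shows "x \<le> y"
proof (rule ennreal_approx_unit)
  fix a :: ennreal assume a: "0 < a" "a < 1"
  then obtain r where r: "a = ennreal r" "0 < r" "r < 1"
    by (cases a) auto
  \<comment> \<open>The factor to be absorbed is \<open>1 / r\<close>, so \<open>t\<close> is its
    cube root.\<close>
  have "x \<le> ennreal (root 3 (1 / r) ^ 3) * y"
    using r by (intro assms) simp
  then have "x \<le> ennreal (1 / r) * y" using r by simp
  then have "a * x \<le> ennreal r * (ennreal (1 / r) * y)"
    using r by (auto intro: mult_left_mono)
  also have "\<dots> = y" using r by (simp add: mult.assoc[symmetric] ennreal_mult[symmetric])
  finally show "a * x \<le> y" .
qed

text \<open>The cover is made disjoint and the bounds are summed. Since this shrinks the pieces, the
  bound is required for every measurable subset of \<open>P i\<close>.\<close>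

lemma emeasure_le_on_countable_cover:
  assumes sets: "sets N = sets M" and I: "countable I"
    and P: "\<And>i. i \<in> I \<Longrightarrow> P i \<in> sets M"
    and le: "\<And>i B. i \<in> I \<Longrightarrow> B \<in> sets M \<Longrightarrow> B \<subseteq> P i \<Longrightarrow> emeasure M B \<le> a * emeasure N B"
    and B: "B \<in> sets M" "B \<subseteq> (\<Union>i\<in>I. P i)"
  shows "emeasure M B \<le> a * emeasure N B"
proof (cases "I = {}")
  case True
  with B show ?thesis by simp
next
  case False
  define p where "p n = P (from_nat_into I n)" for n
  have p: "p n \<in> sets M" for n using P False by (simp add: p_def from_nat_into)
  have p_UN: "(\<Union>n. p n) = (\<Union>i\<in>I. P i)"
    using range_from_nat_into[OF False I] by (metis (no_types, lifting) SUP_cong image_image p_def)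
  define D where "D n = B \<inter> disjointed p n" for n
  have D: "range D \<subseteq> sets M"
    using sets.range_disjointed_sets[of p M] p B unfolding D_def by blast
  have disj: "disjoint_family D"
    using disjoint_family_disjointed[of p] by (auto simp: disjoint_family_on_def D_def)
  have UN: "(\<Union>n. D n) = B"
    using B p_UN UN_disjointed_eq[of p] by (auto simp: D_def)
  have "emeasure M B = (\<Sum>n. emeasure M (D n))"
    using suminf_emeasure[OF D disj] UN by simp
  also have "\<dots> \<le> (\<Sum>n. a * emeasure N (D n))"
  proof (intro suminf_le summableI le)
    show "from_nat_into I n \<in> I" for n using False by (rule from_nat_into)
    show "D n \<in> sets M" for n using D by auto
    show "D n \<subseteq> P (from_nat_into I n)" for n
      using disjointed_subset[of p n] by (auto simp: D_def p_def)
  qed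
  also have "\<dots> = a * (\<Sum>n. emeasure N (D n))" by simp
  also have "(\<Sum>n. emeasure N (D n)) = emeasure N B"
    using suminf_emeasure[of D N] D disj UN sets by simp
  finally show ?thesis .
qed

text \<open>Invertibility of \<open>T x\<close> bounds \<open>norm (T x *v h)\<close> below by a
  multiple of \<open>norm h\<close>, so the errors from differentiating at \<open>x\<close> and from
  replacing \<open>T x\<close> by \<open>T q\<close> are relatively small. Letting \<open>q\<close>
  differ from \<open>x\<close> allows \<open>q\<close> to be drawn from a countable set.\<close>

lemma derivative_linear_comparison:
  fixes f :: "real^2 \<Rightarrow> 'b::real_normed_vector" and T :: "real^2 \<Rightarrow> real^2^2"
  assumes x: "x \<in> S" and der: "(f has_derivative f') (at x within S)"
    and T: "\<And>h. norm (f' h) = norm (T x *v h)" and cont: "continuous_on S T"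
    and det: "det (T x) \<noteq> 0" and t: "1 < t"
  obtains d where "0 < d" "\<And>q. q \<in> S \<Longrightarrow> dist q x < d \<Longrightarrow> \<bar>det (T q)\<bar> \<le> t * \<bar>det (T x)\<bar> \<and> \<bar>det (T x)\<bar> \<le> t * \<bar>det (T q)\<bar>"
    "\<And>q y. q \<in> S \<Longrightarrow> dist q x < d \<Longrightarrow> y \<in> S \<Longrightarrow> dist y x < d \<Longrightarrow>
      norm (T q *v (y - x)) \<le> t * dist (f y) (f x) \<and> dist (f y) (f x) \<le> t * norm (T q *v (y - x))"
proof -
  have "inj ((*v) (T x))" using det by (simp add: inj_matrix_vector_mult invertible_det_nz)
  then obtain c where c: "0 < c" "\<And>h. c * norm h \<le> norm (T x *v h)"
    using linear_inj_bounded_below_pos[OF matrix_vector_mul_linear] by metis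
  define e where "e = c * (t - 1) / (t + 1)" \<comment> \<open>so that \<open>(c + e) / (c - e) = t\<close>\<close>
  have e: "0 < e" using c t by (simp add: e_def)
  \<comment> \<open>Applied with \<open>M = norm h\<close> and \<open>N = norm (T x *v h)\<close>:
    both quantities to be compared lie within \<open>e * M\<close> of \<open>N\<close>, so their
    ratio is at most \<open>t\<close>.\<close>
  have ec: "t * (N - e * M) \<ge> N + e * M" if "c * M \<le> N" for N M :: real
  proof -
    have "e * M * (t + 1) = (t - 1) * (c * M)" using t by (simp add: e_def field_simps)
    also have "\<dots> \<le> (t - 1) * N" using that t by (intro mult_left_mono) auto
    finally show ?thesis by (simp add: algebra_simps)
  qed
  obtain d1 where d1: "0 < d1" "\<And>y. y \<in> S \<Longrightarrow> dist y x < d1 \<Longrightarrow> norm (f y - f x - f' (y - x)) \<le> e * norm (y - x)"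
    using der e unfolding has_derivative_within_alt dist_norm by blast
  obtain d2 where d2: "0 < d2" "\<And>q. q \<in> S \<Longrightarrow> dist q x < d2 \<Longrightarrow> dist (T q) (T x) < e"
    using cont x e unfolding continuous_on_iff by metis
  \<comment> \<open>Lowering the absolute value of \<open>det (T x)\<close> by this amount divides
    it by \<open>t\<close> exactly; raising it stays below a factor \<open>t\<close>, as
    \<open>\<eta> \<le> t * \<eta>\<close>.\<close>
  define \<eta> where "\<eta> = \<bar>det (T x)\<bar> * (t - 1) / t"
  have "0 < \<eta>" using det t by (simp add: \<eta>_def)
  then obtain d3 where d3: "0 < d3" "\<And>q. q \<in> S \<Longrightarrow> dist q x < d3 \<Longrightarrow> dist (det (T q)) (det (T x)) < \<eta>"
    using continuous_on_det_2[OF cont] x unfolding continuous_on_iff by metis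
  show ?thesis
  proof
    show "0 < min d1 (min d2 d3)" using d1 d2 d3 by simp
  next
    fix q assume q: "q \<in> S" "dist q x < min d1 (min d2 d3)"
    have "dist (det (T q)) (det (T x)) < \<eta>" using d3 q by simp
    then have *: "\<bar>det (T q)\<bar> < \<bar>det (T x)\<bar> + \<eta>" "\<bar>det (T x)\<bar> < \<bar>det (T q)\<bar> + \<eta>"
      by (auto simp: dist_real_def)
    have tt: "t * \<eta> = (t - 1) * \<bar>det (T x)\<bar>" using t by (simp add: \<eta>_def)
    have "\<eta> \<le> t * \<eta>" using t \<open>0 < \<eta>\<close> by simp
    then have "\<bar>det (T q)\<bar> \<le> t * \<bar>det (T x)\<bar>" using * tt unfolding left_diff_distrib by linarith
    moreover have "t * \<bar>det (T x)\<bar> \<le> t * (\<bar>det (T q)\<bar> + \<eta>)" using * t by (intro mult_left_mono) auto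
    then have "\<bar>det (T x)\<bar> \<le> t * \<bar>det (T q)\<bar>" using tt by (simp add: algebra_simps)
    ultimately show "\<bar>det (T q)\<bar> \<le> t * \<bar>det (T x)\<bar> \<and> \<bar>det (T x)\<bar> \<le> t * \<bar>det (T q)\<bar>" by simp
  next
    fix q y assume q: "q \<in> S" "dist q x < min d1 (min d2 d3)" and y: "y \<in> S" "dist y x < min d1 (min d2 d3)"
    define h where "h = y - x"
    have "norm (f y - f x - f' h) \<le> e * norm h" using d1 y by (simp add: h_def)
    then have 1: "dist (f y) (f x) \<le> norm (T x *v h) + e * norm h" "norm (T x *v h) - e * norm h \<le> dist (f y) (f x)"
      using norm_triangle_ineq3[of "f y - f x" "f' h"] by (auto simp: T dist_norm)
    have "norm (T q *v h - T x *v h) \<le> norm (T q - T x) * norm h"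
      using norm_matrix_vector_mult_le[of "T q - T x" h] by (simp add: matrix_vector_mult_diff_rdistrib)
    also have "\<dots> \<le> e * norm h"
      using d2(2)[of q] q by (intro mult_right_mono) (auto simp: dist_norm)
    finally have 2: "norm (T q *v h) \<le> norm (T x *v h) + e * norm h" "norm (T x *v h) - e * norm h \<le> norm (T q *v h)"
      using norm_triangle_ineq3[of "T q *v h" "T x *v h"] by auto
    have "norm (T x *v h) + e * norm h \<le> t * (norm (T x *v h) - e * norm h)" using c by (intro ec)
    moreover have "t * (norm (T x *v h) - e * norm h) \<le> t * dist (f y) (f x)" using 1 t by simp
    moreover have "t * (norm (T x *v h) - e * norm h) \<le> t * norm (T q *v h)" using 2 t by simp
    ultimately show "norm (T q *v (y - x)) \<le> t * dist (f y) (f x) \<and> dist (f y) (f x) \<le> t * norm (T q *v (y - x))"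
      using 1 2 unfolding h_def by linarith
  qed
qed

text \<open>The image is Borel as the preimage under the inverse matrix; boundedness of
  \<open>B\<close> keeps the measures finite, so that the real-valued determinant rule
  applies.\<close>

lemma emeasure_lborel_linear_image:
  fixes A :: "real^2^2"
  assumes B: "B \<in> sets borel" "bounded B" and A: "det A \<noteq> 0"
  shows "(*v) A ` B \<in> sets borel" "emeasure lborel ((*v) A ` B) = ennreal \<bar>det A\<bar> * emeasure lborel B"
proof -
  have Bl: "B \<in> lmeasurable" using B by (intro bounded_set_imp_lmeasurable) auto
  obtain A' where inv: "A' ** A = mat 1" "A ** A' = mat 1"
    using A unfolding invertible_det_nz[symmetric] invertible_def by blast
  have im: "(*v) A ` B = (*v) A' -` B"
  proof (rule set_eqI)
    fix y
    have "A' *v (A *v x) = x" "A *v (A' *v x) = x" for x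
      by (simp_all add: matrix_vector_mul_assoc inv)
    then show "y \<in> (*v) A ` B \<longleftrightarrow> y \<in> (*v) A' -` B"
      unfolding image_iff vimage_def mem_Collect_eq by metis
  qed
  have "(*v) A' \<in> borel \<rightarrow>\<^sub>M borel"
    by (intro borel_measurable_continuous_onI linear_continuous_on) auto
  from measurable_sets[OF this B(1)] show bor: "(*v) A ` B \<in> sets borel" by (simp add: im)
  have "(*v) A ` B \<in> lmeasurable" "measure lebesgue ((*v) A ` B) = \<bar>det A\<bar> * measure lebesgue B"
    using measurable_linear_image[OF matrix_vector_mul_linear[of A] Bl] measure_linear_image[OF matrix_vector_mul_linear[of A] Bl]
    by (simp_all add: matrix_of_matrix_vector_mul)
  moreover have "emeasure lebesgue B = emeasure lborel B" "emeasure lebesgue ((*v) A ` B) = emeasure lborel ((*v) A ` B)"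
    using B bor by simp_all
  ultimately show "emeasure lborel ((*v) A ` B) = ennreal \<bar>det A\<bar> * emeasure lborel B"
    using Bl emeasure_eq_measure2[OF Bl] emeasure_eq_measure2[of "(*v) A ` B" lebesgue] by (simp add: ennreal_mult)
qed

section \<open>Borel sets under homeomorphisms and the Borel pieces of the area formula\<close>

lemma closedin_le_preimage:
  fixes a b :: "'a::topological_space \<Rightarrow> real"
  assumes "continuous_on S a" "continuous_on S b"
  shows "closedin (top_of_set S) {x \<in> S. a x \<le> b x}"
proof -
  have "closedin (top_of_set S) (S \<inter> (\<lambda>x. b x - a x) -` {0..})"
    using assms by (intro continuous_closedin_preimage continuous_intros closed_atLeast)
  moreover have "S \<inter> (\<lambda>x. b x - a x) -` {0..} = {x \<in> S. a x \<le> b x}" by auto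
  ultimately show ?thesis by simp
qed

lemma closedin_imp_borel:
  assumes "S \<in> sets borel" "closedin (top_of_set S) B"
  shows "B \<in> sets borel"
  using assms unfolding closedin_closed by auto

lemma homeomorphism_borel_image:
  fixes f :: "'a::topological_space \<Rightarrow> 'b::topological_space"
  assumes hom: "homeomorphism S Y f g" and Y: "Y \<in> sets borel" and B: "B \<in> sets borel" "B \<subseteq> S"
  shows "f ` B \<in> sets borel"
proof -
  have "g \<in> restrict_space borel Y \<rightarrow>\<^sub>M borel"
    using hom by (intro borel_measurable_continuous_on_restrict) (simp add: homeomorphism_def)
  from measurable_sets[OF this B(1)] have "g -` B \<inter> Y \<in> sets borel"
    using Y by (simp add: space_restrict_space sets_restrict_space_iff)
  moreover have "f ` B = g -` B \<inter> Y" using hom B(2) by (force simp: homeomorphism_def)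
  ultimately show ?thesis by simp
qed

text \<open>The condition runs over uncountably many \<open>y\<close>, so countable operations do
  not suffice. Because \<open>dist y x < d\<close> is strict, each implication is a union of
  relatively closed sets, and any intersection of these is relatively closed in
  \<open>S\<close>.\<close>

lemma area_formula_piece_borel:
  fixes f :: "real^2 \<Rightarrow> 'b::real_normed_vector" and T :: "real^2 \<Rightarrow> real^2^2"
  assumes S: "S \<in> sets borel" and f: "continuous_on S f" and T: "continuous_on S T"
  shows "{x \<in> S. \<bar>det A\<bar> \<le> t * \<bar>det (T x)\<bar> \<and> \<bar>det (T x)\<bar> \<le> t * \<bar>det A\<bar> \<and>
      (\<forall>y\<in>S. dist y x < d \<longrightarrow> norm (A *v (y - x)) \<le> t * dist (f y) (f x) \<and> dist (f y) (f x) \<le> t * norm (A *v (y - x)))}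
    \<in> sets borel" (is "?P \<in> _")
proof (cases "S = {}")
  case False
  let ?D = "\<lambda>y. {x \<in> S. d \<le> dist y x} \<union> ({x \<in> S. norm (A *v (y - x)) \<le> t * dist (f y) (f x)} \<inter>
    {x \<in> S. dist (f y) (f x) \<le> t * norm (A *v (y - x))})"
  let ?C = "{x \<in> S. \<bar>det A\<bar> \<le> t * \<bar>det (T x)\<bar>} \<inter> {x \<in> S. \<bar>det (T x)\<bar> \<le> t * \<bar>det A\<bar>}"
  have A: "continuous_on S (\<lambda>x. A *v (y - x))" for y
    by (intro linear_continuous_on_compose[of S "\<lambda>x. y - x" "(*v) A"] continuous_intros) auto
  have "closedin (top_of_set S) (?C \<inter> (\<Inter>y\<in>S. ?D y))"
    using False
    by (intro closedin_Int closedin_INT closedin_Un closedin_le_preimage continuous_intros A f continuous_on_det_2 T) auto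
  moreover have "?D y = {x \<in> S. dist y x < d \<longrightarrow>
      norm (A *v (y - x)) \<le> t * dist (f y) (f x) \<and> dist (f y) (f x) \<le> t * norm (A *v (y - x))}" for y
    by (rule set_eqI) (simp add: not_less[symmetric], blast)
  then have "?P = ?C \<inter> (\<Inter>y\<in>S. ?D y)" using False by blast
  ultimately show ?thesis using closedin_imp_borel[OF S] by simp
qed simp

lemma hausdorff2_area_formula:
  fixes f :: "real^2 \<Rightarrow> 'b::euclidean_space" and T :: "real^2 \<Rightarrow> real^2^2"
  assumes sets_\<nu>: "sets \<nu> = sets borel"
    and \<nu>: "\<And>B. B \<in> sets borel \<Longrightarrow> emeasure \<nu> B = hausdorff2 B"
    and C: "\<And>E :: (real^2) set. E \<in> sets borel \<Longrightarrow> hausdorff2 E = C * emeasure lborel E"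
    and S: "S \<in> sets borel" and Y: "Y \<in> sets borel" and hom: "homeomorphism S Y f g"
    and der: "\<And>x. x \<in> S \<Longrightarrow> (f has_derivative f' x) (at x within S)"
    and norm_f': "\<And>x h. x \<in> S \<Longrightarrow> norm (f' x h) = norm (T x *v h)"
    and T: "continuous_on S T" and det: "\<And>x. x \<in> S \<Longrightarrow> det (T x) \<noteq> 0"
    and E: "E \<in> sets borel" "E \<subseteq> S"
  shows "f ` E \<in> sets borel" and "emeasure \<nu> (f ` E) = C * (\<integral>\<^sup>+x\<in>E. ennreal \<bar>det (T x)\<bar> \<partial>lborel)"
proof -
  have im: "f ` B = g -` B \<inter> Y" if "B \<subseteq> S" for B
    using hom that by (force simp: homeomorphism_def)
  have cont_f: "continuous_on S f" using hom by (simp add: homeomorphism_def)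
  have g: "g \<in> restrict_space \<nu> Y \<rightarrow>\<^sub>M borel"
    using borel_measurable_continuous_on_restrict[of Y g] hom sets_restrict_space_cong[OF sets_\<nu>, of Y]
    by (simp add: homeomorphism_def cong: measurable_cong_sets)
  have space_\<nu>: "space \<nu> = UNIV" using sets_eq_imp_space_eq[OF sets_\<nu>] by simp
  have bor: "f ` B \<in> sets borel" if "B \<in> sets borel" "B \<subseteq> S" for B
    using homeomorphism_borel_image[OF hom Y that] .
  show "f ` E \<in> sets borel" using bor E .
  \<comment> \<open>Pushing forward along the inverse \<open>g\<close> makes the area of the image
    of \<open>B\<close> a measure in \<open>B\<close>, so it can be summed over pieces.\<close>
  define M1 where "M1 = distr (restrict_space \<nu> Y) borel g"
  have M1: "emeasure M1 B = emeasure \<nu> (f ` B)" if "B \<in> sets borel" "B \<subseteq> S" for B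
    using that Y bor im g unfolding M1_def
    by (simp add: emeasure_distr emeasure_restrict_space space_restrict_space space_\<nu> sets_\<nu>)
  define J where "J x = indicator S x *\<^sub>R \<bar>det (T x)\<bar>" for x
  have J[measurable]: "J \<in> borel_measurable borel"
    unfolding J_def using S T
    by (intro borel_measurable_continuous_on_indicator continuous_intros continuous_on_det_2) auto
  have J_eq: "J x = \<bar>det (T x)\<bar>" if "x \<in> S" for x using that by (simp add: J_def)
  define M2 where "M2 = density lborel (\<lambda>x. C * ennreal (J x))"
  have M2: "emeasure M2 B = C * (\<integral>\<^sup>+x\<in>B. ennreal (J x) \<partial>lborel)" if "B \<in> sets borel" for B
    using that unfolding M2_def by (simp add: emeasure_density nn_integral_cmult mult.assoc)
  have cover: "emeasure M1 E \<le> ennreal (t ^ 3) * emeasure M2 E \<and> emeasure M2 E \<le> ennreal (t ^ 3) * emeasure M1 E"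
    if t: "1 < t" for t :: real
  proof -
    obtain Q where Q: "countable Q" "Q \<subseteq> S" "S \<subseteq> closure Q" using separable[of S] by blast
    define A where "A q d = {x \<in> S. \<bar>det (T q)\<bar> \<le> t * \<bar>det (T x)\<bar> \<and> \<bar>det (T x)\<bar> \<le> t * \<bar>det (T q)\<bar> \<and>
      (\<forall>y\<in>S. dist y x < d \<longrightarrow> norm (T q *v (y - x)) \<le> t * dist (f y) (f x) \<and>
         dist (f y) (f x) \<le> t * norm (T q *v (y - x)))}" for q d
    \<comment> \<open>\<open>q\<close> selects the approximating linear map and \<open>n\<close> the
      radius of validity \<open>1 / Suc n\<close>; the ball about \<open>z\<close> has half that
      radius, so any two points of a piece are close enough to be compared.\<close>
    define P where "P = (\<lambda>(q, z, n). A q (1 / Suc n) \<inter> ball z (1 / (2 * Suc n)))"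
    define I where "I = Q \<times> Q \<times> (UNIV :: nat set)"
    have I: "countable I" unfolding I_def using Q by (intro countable_SIGMA) auto
    have P_borel: "P i \<in> sets borel" for i
      unfolding P_def A_def split_beta
      by (intro sets.Int area_formula_piece_borel S cont_f T) auto
    have "S \<subseteq> (\<Union>i\<in>I. P i)"
    proof
      fix x assume x: "x \<in> S"
      obtain d where d: "0 < d" "\<And>q. q \<in> S \<Longrightarrow> dist q x < d \<Longrightarrow> \<bar>det (T q)\<bar> \<le> t * \<bar>det (T x)\<bar> \<and> \<bar>det (T x)\<bar> \<le> t * \<bar>det (T q)\<bar>"
        "\<And>q y. q \<in> S \<Longrightarrow> dist q x < d \<Longrightarrow> y \<in> S \<Longrightarrow> dist y x < d \<Longrightarrow>
          norm (T q *v (y - x)) \<le> t * dist (f y) (f x) \<and> dist (f y) (f x) \<le> t * norm (T q *v (y - x))"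
        using derivative_linear_comparison[OF x der[OF x] norm_f'[OF x] T det[OF x] t] by metis
      obtain n where n: "1 / Suc n < d" using d(1) nat_approx_posE by blast
      have near: "\<exists>q\<in>Q. dist q x < e" if "0 < e" for e
        using that Q(3) x closure_approachable by blast
      obtain q where q: "q \<in> Q" "dist q x < d" using near d(1) by blast
      obtain z where z: "z \<in> Q" "dist z x < 1 / (2 * Suc n)" using near[of "1 / (2 * Suc n)"] by auto
      have "x \<in> A q (1 / Suc n)"
        unfolding A_def using d(2,3)[of q] q Q(2) x n by force
      then have "x \<in> P (q, z, n)" using z by (simp add: P_def)
      then show "x \<in> (\<Union>i\<in>I. P i)" using q z by (auto simp: I_def)
    qed
    with E have cov: "E \<subseteq> (\<Union>i\<in>I. P i)" by blast
    have piece: "emeasure M1 B \<le> ennreal (t ^ 3) * emeasure M2 B \<and> emeasure M2 B \<le> ennreal (t ^ 3) * emeasure M1 B"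
      if i: "i \<in> I" and B: "B \<in> sets borel" "B \<subseteq> P i" for i B
    proof -
      obtain q z n where qzn: "i = (q, z, n)" "q \<in> S" using i Q(2) by (auto simp: I_def)
      then have BA: "B \<subseteq> A q (1 / Suc n)" and Bz: "B \<subseteq> ball z (1 / (2 * Suc n))" using B by (auto simp: P_def)
      then have BS: "B \<subseteq> S" by (auto simp: A_def)
      have bB: "bounded B" using Bz bounded_ball bounded_subset by blast
      have lip: "norm (T q *v (y - x)) \<le> t * dist (f y) (f x) \<and> dist (f y) (f x) \<le> t * norm (T q *v (y - x))"
        if xy: "x \<in> B" "y \<in> B" for x y
      proof -
        have "dist z x < 1 / (2 * Suc n)" "dist z y < 1 / (2 * Suc n)" using xy Bz by auto
        then have "dist y x < 1 / (2 * Suc n) + 1 / (2 * Suc n)"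
          by (intro dist_triangle_less_add[of y z]) (auto simp: dist_commute)
        also have "\<dots> = 1 / Suc n" by (simp add: field_simps)
        finally show ?thesis using BA BS xy unfolding A_def by blast
      qed
      have t3: "ennreal (t ^ 3) = ennreal (t\<^sup>2) * ennreal t"
        using t by (simp add: ennreal_mult[symmetric] power3_eq_cube power2_eq_square)
      note lin = emeasure_lborel_linear_image[OF B(1) bB det[OF qzn(2)]]
      \<comment> \<open>The area of the linear image mediates between the two measures: it is within
        a factor \<open>t\<^sup>2\<close> of \<open>M1\<close> by the Lipschitz bounds and within
        \<open>t\<close> of \<open>M2\<close> by the determinant bounds.\<close>
      define V where "V = hausdorff2 ((*v) (T q) ` B)"
      have V: "V = C * (\<integral>\<^sup>+x\<in>B. ennreal \<bar>det (T q)\<bar> \<partial>lborel)"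
        unfolding V_def using lin C B by (simp add: nn_integral_cmult_indicator)
      have "hausdorff2 (f ` B) \<le> ennreal (t\<^sup>2) * V" "V \<le> ennreal (t\<^sup>2) * hausdorff2 (f ` B)"
        unfolding V_def using t lip
        by (auto intro!: hausdorff2_image_le simp: dist_norm matrix_vector_mult_diff_distrib[symmetric])
      then have h: "emeasure M1 B \<le> ennreal (t\<^sup>2) * V" "V \<le> ennreal (t\<^sup>2) * emeasure M1 B"
        using M1[OF B(1) BS] \<nu>[OF bor[OF B(1) BS]] by simp_all
      have "V \<le> C * (\<integral>\<^sup>+x. ennreal t * (ennreal (J x) * indicator B x) \<partial>lborel)"
        unfolding V using BA t
        by (intro mult_left_mono nn_integral_mono)
          (auto simp: A_def J_eq ennreal_mult[symmetric] intro!: ennreal_leI split: split_indicator)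
      then have V1: "V \<le> ennreal t * emeasure M2 B"
        using B by (simp add: M2 nn_integral_cmult mult_ac)
      have "(\<integral>\<^sup>+x\<in>B. ennreal (J x) \<partial>lborel) \<le> (\<integral>\<^sup>+x. ennreal t * (ennreal \<bar>det (T q)\<bar> * indicator B x) \<partial>lborel)"
        using BA t
        by (intro nn_integral_mono)
          (auto simp: A_def J_eq ennreal_mult[symmetric] intro!: ennreal_leI split: split_indicator)
      also have "\<dots> = ennreal t * (\<integral>\<^sup>+x\<in>B. ennreal \<bar>det (T q)\<bar> \<partial>lborel)"
        using B(1) by (intro nn_integral_cmult borel_measurable_times_ennreal borel_measurable_const borel_measurable_indicator) simp
      finally have "C * (\<integral>\<^sup>+x\<in>B. ennreal (J x) \<partial>lborel) \<le> C * (ennreal t * (\<integral>\<^sup>+x\<in>B. ennreal \<bar>det (T q)\<bar> \<partial>lborel))"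
        by (rule mult_left_mono) simp
      then have V2: "emeasure M2 B \<le> ennreal t * V"
        using B by (simp add: M2 V mult_ac)
      show ?thesis
        using h V1 V2 mult_left_mono[OF V1, of "ennreal (t\<^sup>2)"] mult_left_mono[OF h(2), of "ennreal t"]
        by (auto simp: t3 mult_ac intro: order_trans)
    qed
    have "sets M1 = sets borel" "sets M2 = sets borel" by (simp_all add: M1_def M2_def)
    then show ?thesis
      using emeasure_le_on_countable_cover[of M2 M1 I P "ennreal (t ^ 3)" E]
        emeasure_le_on_countable_cover[of M1 M2 I P "ennreal (t ^ 3)" E] I P_borel piece E cov by auto
  qed
  have "emeasure M1 E = emeasure M2 E"
    by (rule antisym; rule ennreal_le_mult_gt_1) (use cover in blast)+
  moreover have "(\<integral>\<^sup>+x\<in>E. ennreal (J x) \<partial>lborel) = (\<integral>\<^sup>+x\<in>E. ennreal \<bar>det (T x)\<bar> \<partial>lborel)"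
    using E J_eq by (intro nn_integral_cong) (auto split: split_indicator)
  ultimately show "emeasure \<nu> (f ` E) = C * (\<integral>\<^sup>+x\<in>E. ennreal \<bar>det (T x)\<bar> \<partial>lborel)"
    using M1 M2 E by simp
qed

text \<open>The area identity on sets says that \<open>\<nu>\<close> on \<open>Y\<close> is the
  image under \<open>h\<close> of the measure with density \<open>J\<close>, because each Borel part
  of \<open>Y\<close> is the image of its preimage; integrals then follow.\<close>

lemma nn_integral_transfer:
  fixes h :: "'a::euclidean_space \<Rightarrow> 'b::topological_space"
  assumes sets_\<nu>: "sets \<nu> = sets borel" and hom: "homeomorphism S Y h k"
    and S: "S \<in> sets borel" and Y: "Y \<in> sets borel"
    and J: "J \<in> borel_measurable (restrict_space borel S)"
    and area: "\<And>E. E \<in> sets borel \<Longrightarrow> E \<subseteq> S \<Longrightarrow> emeasure \<nu> (h ` E) = (\<integral>\<^sup>+s\<in>E. J s \<partial>lborel)"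
    and p: "p \<in> borel_measurable (restrict_space \<nu> Y)"
  shows "(\<integral>\<^sup>+y. p y \<partial>restrict_space \<nu> Y) = (\<integral>\<^sup>+s\<in>S. J s * p (h s) \<partial>lborel)"
proof -
  have space_\<nu>: "space \<nu> = UNIV" using sets_eq_imp_space_eq[OF sets_\<nu>] by simp
  let ?L = "restrict_space lborel S"
  have J': "J \<in> borel_measurable ?L"
    using J by (simp cong: measurable_cong_sets add: sets_restrict_space_cong[of lborel borel])
  have h: "h \<in> ?L \<rightarrow>\<^sub>M restrict_space \<nu> Y"
  proof (rule measurable_restrict_space2)
    show "h \<in> space ?L \<rightarrow> Y" using hom by (auto simp: homeomorphism_def space_restrict_space)
    have "h \<in> restrict_space borel S \<rightarrow>\<^sub>M borel"
      using hom by (intro borel_measurable_continuous_on_restrict) (simp add: homeomorphism_def)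
    then show "h \<in> ?L \<rightarrow>\<^sub>M \<nu>"
      using sets_\<nu> sets_restrict_space_cong[of lborel borel S] by (simp cong: measurable_cong_sets)
  qed
  have eq: "distr (density ?L J) (restrict_space \<nu> Y) h = restrict_space \<nu> Y"
  proof (rule measure_eqI)
    fix B assume "B \<in> sets (distr (density ?L J) (restrict_space \<nu> Y) h)"
    then have B: "B \<in> sets (restrict_space \<nu> Y)" by simp
    then have B': "B \<in> sets borel" "B \<subseteq> Y" using Y by (auto simp: sets_restrict_space_iff sets_\<nu>)
    define E where "E = h -` B \<inter> S"
    have E: "E \<in> sets borel" "E \<subseteq> S"
      using measurable_sets[OF h B] S by (auto simp: E_def space_restrict_space sets_restrict_space_iff)
    have "h ` E = B" using hom B' by (force simp: homeomorphism_def E_def)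
    have "emeasure (distr (density ?L J) (restrict_space \<nu> Y) h) B = emeasure (density ?L J) E"
      using h B by (subst emeasure_distr) (auto simp: E_def space_restrict_space)
    also have "\<dots> = (\<integral>\<^sup>+s. J s * indicator E s \<partial>?L)"
      using J' E S by (intro emeasure_density) (auto simp: sets_restrict_space_iff)
    also have "\<dots> = (\<integral>\<^sup>+s\<in>E. J s \<partial>lborel)"
      using S E by (subst nn_integral_restrict_space) (auto intro!: nn_integral_cong split: split_indicator)
    also have "\<dots> = emeasure (restrict_space \<nu> Y) B"
      using area[OF E] \<open>h ` E = B\<close> B' Y by (simp add: emeasure_restrict_space sets_\<nu>)
    finally show "emeasure (distr (density ?L J) (restrict_space \<nu> Y) h) B = emeasure (restrict_space \<nu> Y) B" .
  qed simp
  have "(\<integral>\<^sup>+y. p y \<partial>restrict_space \<nu> Y) = (\<integral>\<^sup>+y. p y \<partial>distr (density ?L J) (restrict_space \<nu> Y) h)"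
    by (simp add: eq)
  also have "\<dots> = (\<integral>\<^sup>+s. p (h s) \<partial>density ?L J)"
    using h p by (intro nn_integral_distr) simp_all
  also have "\<dots> = (\<integral>\<^sup>+s. J s * p (h s) \<partial>?L)"
    using J' measurable_compose[OF h p] by (intro nn_integral_density) simp_all
  also have "\<dots> = (\<integral>\<^sup>+s\<in>S. J s * p (h s) \<partial>lborel)"
    using S by (subst nn_integral_restrict_space) auto
  finally show ?thesis .
qed

section \<open>Area on the manifold of variations\<close>

text \<open>
  The Cholesky factor \<open>T\<close> of \<open>I + B\<^sup>T B\<close>: the graph map \<open>h \<mapsto> (B h, h)\<close> is \<open>T\<close> followed by an isometry.
\<close>

definition gram_factor :: "real^2^'n \<Rightarrow> real^2^2" where
  "gram_factor B =
     (let a = 1 + column 1 B \<bullet> column 1 B; b = column 1 B \<bullet> column 2 B; d = 1 + column 2 B \<bullet> column 2 B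
      in vector [vector [sqrt a, b / sqrt a], vector [0, sqrt (d - b\<^sup>2 / a)]])"

text \<open>This is the Schur complement in \<open>I + B^T B\<close>, the square of the last
  diagonal entry of the Cholesky factor. Cauchy-Schwarz becomes strict through the added
  ones.\<close>

lemma gram_factor_schur_pos:
  fixes B :: "real^2^'n"
  shows "0 < (1 + column 2 B \<bullet> column 2 B) - (column 1 B \<bullet> column 2 B)\<^sup>2 / (1 + column 1 B \<bullet> column 1 B)"
proof -
  have "(column 1 B \<bullet> column 2 B)\<^sup>2 \<le> (column 1 B \<bullet> column 1 B) * (column 2 B \<bullet> column 2 B)"
    by (rule Cauchy_Schwarz_ineq)
  also have "\<dots> < (1 + column 2 B \<bullet> column 2 B) * (1 + column 1 B \<bullet> column 1 B)"
    by (simp add: algebra_simps add_pos_nonneg)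
  finally show ?thesis
    by (simp add: pos_divide_less_eq add_pos_nonneg)
qed

text \<open>The identity \<open>T^T T = I + B^T B\<close> read as an equality of quadratic forms:
  the first coordinate of \<open>T h\<close> completes the square in \<open>h $ 1\<close>, the
  second carries the remainder.\<close>

lemma norm_gram_factor: "norm (gram_factor B *v h) = norm (B *v h, h)" for B :: "real^2^'n"
proof -
  define a b d where abd: "a = 1 + column 1 B \<bullet> column 1 B" "b = column 1 B \<bullet> column 2 B" "d = 1 + column 2 B \<bullet> column 2 B"
  have a: "0 < a" by (simp add: abd add_pos_nonneg)
  have s: "0 \<le> d - b\<^sup>2 / a" using gram_factor_schur_pos[of B] by (simp add: abd)
  have B: "B *v h = (h $ 1) *\<^sub>R column 1 B + (h $ 2) *\<^sub>R column 2 B"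
    by (simp add: matrix_mult_sum sum_2 scalar_mult_eq_scaleR)
  have hh: "(norm x)\<^sup>2 = (x $ 1)\<^sup>2 + (x $ 2)\<^sup>2" for x :: "real^2"
    unfolding power2_norm_eq_inner by (simp add: inner_vec_def sum_2 power2_eq_square)
  have comp: "(gram_factor B *v h) $ 1 = sqrt a * h $ 1 + b / sqrt a * h $ 2" "(gram_factor B *v h) $ 2 = sqrt (d - b\<^sup>2 / a) * h $ 2"
    by (simp_all add: gram_factor_def abd[symmetric] matrix_vector_mult_def sum_2)
  have "(norm (gram_factor B *v h))\<^sup>2 = (sqrt a * h $ 1 + b / sqrt a * h $ 2)\<^sup>2 + (d - b\<^sup>2 / a) * (h $ 2)\<^sup>2"
    unfolding hh comp using s by (simp add: power_mult_distrib)
  also have "(sqrt a * h $ 1 + b / sqrt a * h $ 2)\<^sup>2 = a * (h $ 1)\<^sup>2 + 2 * b * h $ 1 * h $ 2 + b\<^sup>2 / a * (h $ 2)\<^sup>2"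
    using a by (simp add: power2_sum power_mult_distrib power_divide)
  also have "a * (h $ 1)\<^sup>2 + 2 * b * h $ 1 * h $ 2 + b\<^sup>2 / a * (h $ 2)\<^sup>2 + (d - b\<^sup>2 / a) * (h $ 2)\<^sup>2
      = a * (h $ 1)\<^sup>2 + 2 * b * h $ 1 * h $ 2 + d * (h $ 2)\<^sup>2"
    by (simp add: algebra_simps)
  also have "\<dots> = (norm (B *v h))\<^sup>2 + (norm h)\<^sup>2"
    unfolding hh[of h] B unfolding power2_norm_eq_inner
    by (simp add: abd inner_add_left inner_add_right inner_commute power2_eq_square algebra_simps)
  also have "\<dots> = (norm (B *v h, h))\<^sup>2" by (simp add: norm_Pair)
  finally show ?thesis by (simp add: power2_eq_iff_nonneg)
qed

lemma det_gram_factor: "det (gram_factor B) = sqrt (det (mat 1 + transpose B ** B))" for B :: "real^2^'n"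
proof -
  define a b d where abd: "a = 1 + column 1 B \<bullet> column 1 B" "b = column 1 B \<bullet> column 2 B" "d = 1 + column 2 B \<bullet> column 2 B"
  have a: "0 < a" by (simp add: abd add_pos_nonneg)
  have ent: "(transpose B ** B) $ i $ j = column i B \<bullet> column j B" for i j
    by (simp add: matrix_matrix_mult_def transpose_def column_def inner_vec_def)
  have "det (mat 1 + transpose B ** B) = a * d - b\<^sup>2"
    by (simp add: det_2 ent mat_def abd power2_eq_square inner_commute)
  also have "\<dots> = a * (d - b\<^sup>2 / a)" using a by (simp add: algebra_simps)
  finally show ?thesis
    by (simp add: gram_factor_def abd[symmetric] det_2 real_sqrt_mult)
qed

lemma det_gram_factor_pos: "0 < det (gram_factor B)" for B :: "real^2^'n"
  using gram_factor_schur_pos[of B] by (simp add: gram_factor_def Let_def det_2 add_pos_nonneg)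

lemma continuous_on_vector_2:
  fixes u v :: "'a::topological_space \<Rightarrow> 'b::real_normed_vector"
  assumes "continuous_on S u" "continuous_on S v"
  shows "continuous_on S (\<lambda>x. vector [u x, v x] :: 'b^2)"
proof -
  have "(vector [u x, v x] :: 'b^2) = (\<chi> i. if i = 1 then u x else v x)" for x
    by (simp add: vec_eq_iff forall_2)
  moreover have "continuous_on S (\<lambda>x. if i = 1 then u x else v x)" for i :: 2
    using assms by (cases "i = 1") auto
  ultimately show ?thesis by (simp add: continuous_on_vec_lambda)
qed

lemma continuous_on_gram_factor:
  fixes B :: "'a::topological_space \<Rightarrow> real^2^'n"
  assumes "continuous_on S B"
  shows "continuous_on S (\<lambda>x. gram_factor (B x))"
proof -
  have col: "continuous_on S (\<lambda>x. column i (B x))" for i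
    unfolding column_def by (intro continuous_intros assms)
  have nz: "1 + column 1 (B x) \<bullet> column 1 (B x) \<noteq> 0" for x
    using inner_ge_zero[of "column 1 (B x)"] by linarith
  show ?thesis
    unfolding gram_factor_def Let_def
    by (intro continuous_on_vector_2 continuous_intros col) (auto simp: nz)
qed

text \<open>The coordinate expression is valid only near \<open>\<rho>\<close>, which is enough for
  a derivative there. Lengths survive the passage from coordinates to the ambient space because the
  circle is parametrized by arc length.\<close>

lemma has_attr_jacobian_derivative:
  assumes "has_attr_jacobian A J \<rho> T" "\<rho> \<in> T"
  obtains L where "(A has_derivative L) (at \<rho> within T)" "\<And>h. norm (L h) = norm (J *v h)"
proof -
  obtain c e where e: "0 < e" and c: "\<forall>\<rho>'\<in>T \<inter> ball \<rho> e. attr_of_coords (c \<rho>') = A \<rho>'"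
    and der: "(c has_derivative (\<lambda>h. J *v h)) (at \<rho> within T)"
    using assms(1) unfolding has_attr_jacobian_def by blast
  \<comment> \<open>\<open>\<i> * cis (c \<rho> $ 1)\<close> is the unit tangent vector of the
    circle.\<close>
  define L where "L h = (((J *v h) $ 1) *\<^sub>R (\<i> * cis (c \<rho> $ 1)), (J *v h) $ 2, (J *v h) $ 3, (J *v h) $ 4)" for h
  have comp: "((\<lambda>\<rho>. c \<rho> $ i) has_derivative (\<lambda>h. (J *v h) $ i)) (at \<rho> within T)" for i
    using der by (rule bounded_linear.has_derivative[OF bounded_linear_vec_nth])
  have "((\<lambda>\<rho>. attr_of_coords (c \<rho>)) has_derivative L) (at \<rho> within T)"
    unfolding attr_of_coords_def L_def by (intro has_derivative_Pair has_derivative_cis comp)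
  then have "(A has_derivative L) (at \<rho> within T)"
    by (rule has_derivative_transform_within[OF _ e assms(2)]) (simp add: c dist_commute)
  moreover have "norm (L h) = norm (J *v h)" for h
    by (simp add: L_def norm_Pair norm_vec_def L2_set_def sum_4 norm_mult add.assoc)
  ultimately show ?thesis using that by blast
qed

section \<open>The manifold as a graph\<close>

lemma mov_param_homeomorphism:
  assumes "continuous_on T A"
  shows "homeomorphism T (mov_param A ` T) (mov_param A) snd"
  using assms unfolding homeomorphism_def
  by (auto simp: mov_param_def[abs_def] image_image intro!: continuous_intros)

text \<open>The graph of a continuous map is the zero set of \<open>A (snd x) - fst x\<close>,
  relatively closed in the Borel set \<open>UNIV \<times> T\<close>.\<close>

lemma mov_param_image_borel:
  assumes A: "continuous_on T A" and T: "T \<in> sets borel"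
  shows "mov_param A ` T \<in> sets borel"
proof (rule closedin_imp_borel)
  show "(UNIV :: attributable set) \<times> T \<in> sets borel"
    using T by (subst borel_prod[symmetric]) auto
  have "closedin (top_of_set (UNIV \<times> T)) ((UNIV \<times> T) \<inter> (\<lambda>x. A (snd x) - fst x) -` {0})"
    by (intro continuous_closedin_preimage continuous_intros continuous_on_compose2[OF A]) auto
  moreover have "mov_param A ` T = (UNIV \<times> T) \<inter> (\<lambda>x. A (snd x) - fst x) -` {0}"
  proof (rule set_eqI)
    fix x
    have "x \<in> mov_param A ` T \<longleftrightarrow> snd x \<in> T \<and> A (snd x) = fst x"
      unfolding mov_param_def image_iff by (metis fst_conv snd_conv prod.collapse)
    then show "x \<in> mov_param A ` T \<longleftrightarrow> x \<in> (UNIV \<times> T) \<inter> (\<lambda>x. A (snd x) - fst x) -` {0}"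
      by (simp only: mem_Times_iff vimage_eq Int_iff UNIV_I simp_thms singleton_iff right_minus_eq)
  qed
  ultimately show "closedin (top_of_set (UNIV \<times> T)) (mov_param A ` T)" by simp
qed

lemma continuous_on_has_attr_jacobian:
  assumes "\<And>\<rho>. \<rho> \<in> T \<Longrightarrow> has_attr_jacobian A (DA \<rho>) \<rho> T"
  shows "continuous_on T A"
  using assms has_attr_jacobian_derivative has_derivative_continuous
  unfolding continuous_on_eq_continuous_within by metis

text \<open>Stated for a general \<open>\<phi>\<close> because two choices occur: the sampling map,
  and the identity for null sets of the manifold.\<close>

lemma mov_param_area:
  fixes \<phi> :: "real^2 \<Rightarrow> real^2"
  assumes sets_\<nu>: "sets \<nu> = sets borel"
    and \<nu>: "\<And>B. B \<in> sets borel \<Longrightarrow> emeasure \<nu> B = hausdorff2 B"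
    and C: "\<And>E :: (real^2) set. E \<in> sets borel \<Longrightarrow> hausdorff2 E = C * emeasure lborel E"
    and A: "\<And>\<rho>. \<rho> \<in> T \<Longrightarrow> has_attr_jacobian A (DA \<rho>) \<rho> T" and DA: "continuous_on T DA"
    and S: "S \<in> sets borel" and \<phi>S: "\<phi> ` S \<in> sets borel" "\<phi> ` S \<subseteq> T" and hom: "homeomorphism S (\<phi> ` S) \<phi> g"
    and \<phi>: "\<And>s. s \<in> S \<Longrightarrow> (\<phi> has_derivative (\<lambda>h. J s *v h)) (at s within S)"
    and J: "continuous_on S J" "\<And>s. s \<in> S \<Longrightarrow> det (J s) \<noteq> 0"
  shows "homeomorphism S ((\<lambda>s. mov_param A (\<phi> s)) ` S) (\<lambda>s. mov_param A (\<phi> s)) (\<lambda>x. g (snd x))"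
    and "(\<lambda>s. mov_param A (\<phi> s)) ` S \<in> sets borel"
    and "\<And>E. E \<in> sets borel \<Longrightarrow> E \<subseteq> S \<Longrightarrow> emeasure \<nu> ((\<lambda>s. mov_param A (\<phi> s)) ` E) =
      C * (\<integral>\<^sup>+s\<in>E. ennreal (sqrt (gram_mu DA (\<phi> s)) * \<bar>det (J s)\<bar>) \<partial>lborel)"
proof -
  have cA: "continuous_on T A" using continuous_on_has_attr_jacobian A .
  have homA: "homeomorphism (\<phi> ` S) (mov_param A ` \<phi> ` S) (mov_param A) snd"
    using cA \<phi>S(2) continuous_on_subset by (intro mov_param_homeomorphism) blast
  show hom': "homeomorphism S ((\<lambda>s. mov_param A (\<phi> s)) ` S) (\<lambda>s. mov_param A (\<phi> s)) (\<lambda>x. g (snd x))"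
    using homeomorphism_compose[OF hom homA] by (simp add: o_def image_image)
  show bor: "(\<lambda>s. mov_param A (\<phi> s)) ` S \<in> sets borel"
    using mov_param_image_borel[OF continuous_on_subset[OF cA \<phi>S(2)] \<phi>S(1)] by (simp add: image_image)
  obtain L where L: "\<And>\<rho>. \<rho> \<in> T \<Longrightarrow> (A has_derivative L \<rho>) (at \<rho> within T)"
    "\<And>\<rho> h. \<rho> \<in> T \<Longrightarrow> norm (L \<rho> h) = norm (DA \<rho> *v h)"
  proof -
    have "\<forall>\<rho>\<in>T. \<exists>l. (A has_derivative l) (at \<rho> within T) \<and> (\<forall>h. norm (l h) = norm (DA \<rho> *v h))"
      using has_attr_jacobian_derivative[OF A] by metis
    then show ?thesis using that by metis
  qed
  \<comment> \<open>By the chain rule the composite has differential \<open>J s\<close> followed by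
    the graph map, whose lengths are those of \<open>gram_factor\<close>.\<close>
  define D where "D s = gram_factor (DA (\<phi> s)) ** J s" for s
  have detD: "\<bar>det (D s)\<bar> = sqrt (gram_mu DA (\<phi> s)) * \<bar>det (J s)\<bar>" for s
    using det_gram_factor_pos[of "DA (\<phi> s)"]
    by (simp add: D_def det_mul abs_mult det_gram_factor gram_mu_def)
  have c\<phi>: "continuous_on S \<phi>" using hom by (simp add: homeomorphism_def)
  have "continuous_on S (\<lambda>s. DA (\<phi> s))"
    using DA c\<phi> \<phi>S(2) by (rule continuous_on_compose2)
  then have cont: "continuous_on S D"
    unfolding D_def matrix_matrix_mult_def
    by (intro continuous_intros continuous_on_gram_factor J)
  have der: "((\<lambda>s. mov_param A (\<phi> s)) has_derivative (\<lambda>h. (L (\<phi> s) (J s *v h), J s *v h))) (at s within S)"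
    if s: "s \<in> S" for s
    unfolding mov_param_def
    using has_derivative_in_compose2[OF L(1) \<phi>S(2) s \<phi>[OF s]] \<phi>[OF s] by (intro has_derivative_Pair)
  have norm: "norm (L (\<phi> s) (J s *v h), J s *v h) = norm (D s *v h)" if "s \<in> S" for s h
  proof -
    have "norm (D s *v h) = norm (DA (\<phi> s) *v (J s *v h), J s *v h)"
      by (simp add: D_def matrix_vector_mul_assoc[symmetric] norm_gram_factor)
    also have "\<dots> = norm (L (\<phi> s) (J s *v h), J s *v h)"
      using that \<phi>S(2) L(2) by (auto simp: norm_Pair)
    finally show ?thesis by simp
  qed
  have det: "det (D s) \<noteq> 0" if "s \<in> S" for s
    using J(2)[OF that] det_gram_factor_pos[of "DA (\<phi> s)"] by (simp add: D_def det_mul)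
  fix E assume E: "E \<in> sets borel" "E \<subseteq> S"
  show "emeasure \<nu> ((\<lambda>s. mov_param A (\<phi> s)) ` E) =
      C * (\<integral>\<^sup>+s\<in>E. ennreal (sqrt (gram_mu DA (\<phi> s)) * \<bar>det (J s)\<bar>) \<partial>lborel)"
    unfolding detD[symmetric]
    by (rule hausdorff2_area_formula(2)[where f' = "\<lambda>s h. (L (\<phi> s) (J s *v h), J s *v h)" and T = D, OF sets_\<nu> \<nu> C S bor hom' der norm cont det E])
qed

section \<open>The sampling maps\<close>

lemma jacobian_eqI:
  fixes f :: "real^'n \<Rightarrow> real^'m"
  assumes "(f has_derivative (\<lambda>h. J *v h)) (at x)"
  shows "jacobian f (at x) = J"
  unfolding jacobian_def frechet_derivative_at[OF assms, symmetric] by simp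

lemma has_derivative_vector_2:
  assumes a: "(a has_derivative a') F" and b: "(b has_derivative b') F"
  shows "((\<lambda>s. vector [a s, b s] :: real^2) has_derivative (\<lambda>h. vector [a' h, b' h])) F"
proof -
  have eq: "(vector [u, v] :: real^2) = u *\<^sub>R axis 1 1 + v *\<^sub>R axis 2 1" for u v
    by (simp add: vec_eq_iff forall_2 axis_def)
  show ?thesis
    unfolding eq by (intro has_derivative_add has_derivative_scaleR_left a b)
qed

fun f_sigma_jacobian :: "sampling \<Rightarrow> real^2 \<Rightarrow> real^2^2" where
  "f_sigma_jacobian Uniform_range s = mat 1"
| "f_sigma_jacobian Uniform_log_range s = vector [vector [ln 10 * 10 powr (s $ 1), 0], vector [0, 1]]"
| "f_sigma_jacobian (Cobweb x l1 l2 v) s =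
     vector [vector [sqrt l1 * cos (s $ 2) * v $ 1 - sqrt l2 * sin (s $ 2) * v $ 2,
                     s $ 1 * (- (sqrt l1 * sin (s $ 2) * v $ 1) - sqrt l2 * cos (s $ 2) * v $ 2)],
             vector [sqrt l2 * sin (s $ 2) * v $ 1 + sqrt l1 * cos (s $ 2) * v $ 2,
                     s $ 1 * (sqrt l2 * cos (s $ 2) * v $ 1 - sqrt l1 * sin (s $ 2) * v $ 2)]]"

lemma f_sigma_cobweb_vector:
  "f_sigma (Cobweb x l1 l2 v) s =
     vector [s $ 1 * (sqrt l1 * cos (s $ 2) * v $ 1 - sqrt l2 * sin (s $ 2) * v $ 2) + snd x $ 1,
             s $ 1 * (sqrt l2 * sin (s $ 2) * v $ 1 + sqrt l1 * cos (s $ 2) * v $ 2) + snd x $ 2]"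
  by (simp add: vec_eq_iff forall_2 matrix_vector_mult_def sum_2)

lemma f_sigma_has_derivative: "(f_sigma t has_derivative (\<lambda>h. f_sigma_jacobian t s *v h)) (at s)"
proof (cases t)
  case Uniform_range
  then have "f_sigma t = (\<lambda>s. s)" by auto
  then show ?thesis using Uniform_range by simp
next
  case Uniform_log_range
  have "((\<lambda>s :: real^2. vector [10 powr (s $ 1), s $ 2] :: real^2) has_derivative
      (\<lambda>h. vector [h $ 1 * (ln 10 * 10 powr (s $ 1)), h $ 2])) (at s)"
    by (intro has_derivative_vector_2) (auto intro!: derivative_eq_intros bounded_linear.has_derivative[OF bounded_linear_vec_nth])
  moreover have "f_sigma t = (\<lambda>s. vector [10 powr (s $ 1), s $ 2])" using Uniform_log_range by auto
  moreover have "(\<lambda>h. f_sigma_jacobian t s *v h) = (\<lambda>h. vector [h $ 1 * (ln 10 * 10 powr (s $ 1)), h $ 2])"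
    using Uniform_log_range by (simp add: fun_eq_iff vec_eq_iff forall_2 matrix_vector_mult_def sum_2)
  ultimately show ?thesis by simp
next
  case (Cobweb x l1 l2 v)
  have nth: "((\<lambda>s :: real^2. s $ i) has_derivative (\<lambda>h. h $ i)) (at s)" for i
    by (rule bounded_linear.has_derivative[OF bounded_linear_vec_nth]) simp
  have "((\<lambda>s :: real^2. s $ 1 * (sqrt l1 * cos (s $ 2) * v $ 1 - sqrt l2 * sin (s $ 2) * v $ 2) + snd x $ 1) has_derivative
      (\<lambda>h. (f_sigma_jacobian t s *v h) $ 1)) (at s)"
    unfolding Cobweb
    by (auto intro!: derivative_eq_intros nth simp: fun_eq_iff matrix_vector_mult_def sum_2 algebra_simps)
  moreover have "((\<lambda>s :: real^2. s $ 1 * (sqrt l2 * sin (s $ 2) * v $ 1 + sqrt l1 * cos (s $ 2) * v $ 2) + snd x $ 2) has_derivative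
      (\<lambda>h. (f_sigma_jacobian t s *v h) $ 2)) (at s)"
    unfolding Cobweb
    by (auto intro!: derivative_eq_intros nth simp: fun_eq_iff matrix_vector_mult_def sum_2 algebra_simps)
  ultimately have "((\<lambda>s :: real^2. vector [s $ 1 * (sqrt l1 * cos (s $ 2) * v $ 1 - sqrt l2 * sin (s $ 2) * v $ 2) + snd x $ 1,
             s $ 1 * (sqrt l2 * sin (s $ 2) * v $ 1 + sqrt l1 * cos (s $ 2) * v $ 2) + snd x $ 2] :: real^2) has_derivative
      (\<lambda>h. vector [(f_sigma_jacobian t s *v h) $ 1, (f_sigma_jacobian t s *v h) $ 2])) (at s)"
    by (rule has_derivative_vector_2)
  moreover have "(\<lambda>h. vector [(f_sigma_jacobian t s *v h) $ 1, (f_sigma_jacobian t s *v h) $ 2]) = (\<lambda>h. f_sigma_jacobian t s *v h)"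
    by (simp add: fun_eq_iff vec_eq_iff forall_2)
  moreover have "f_sigma t = (\<lambda>s. vector [s $ 1 * (sqrt l1 * cos (s $ 2) * v $ 1 - sqrt l2 * sin (s $ 2) * v $ 2) + snd x $ 1,
             s $ 1 * (sqrt l2 * sin (s $ 2) * v $ 1 + sqrt l1 * cos (s $ 2) * v $ 2) + snd x $ 2])"
    unfolding Cobweb by (rule ext) (rule f_sigma_cobweb_vector)
  ultimately show ?thesis by simp
qed

lemma continuous_on_f_sigma_jacobian: "continuous_on S (f_sigma_jacobian t)"
proof (cases t)
  case Uniform_range
  then have "f_sigma_jacobian t = (\<lambda>s. mat 1)" by auto
  then show ?thesis by simp
next
  case Uniform_log_range
  then have "f_sigma_jacobian t = (\<lambda>s. vector [vector [ln 10 * 10 powr (s $ 1), 0], vector [0, 1]])" by auto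
  then show ?thesis by (auto intro!: continuous_on_vector_2 continuous_intros)
next
  case (Cobweb x l1 l2 v)
  show ?thesis
    unfolding Cobweb f_sigma_jacobian.simps[abs_def]
    by (intro continuous_on_vector_2 continuous_intros)
qed

text \<open>
  The restriction to an open set serves two purposes: the cobweb map is injective only away from
  \<open>r = 0\<close>, and by invariance of domain injectivity then provides a continuous inverse.
\<close>

fun sampling_interior :: "sampling \<Rightarrow> (real^2) set" where
  "sampling_interior Uniform_range = {s. 0 < s $ 1}"
| "sampling_interior Uniform_log_range = UNIV"
| "sampling_interior (Cobweb x l1 l2 v) = {s. 0 < s $ 1 \<and> 0 < s $ 2 \<and> s $ 2 < 2 * pi}"

lemma open_sampling_interior: "open (sampling_interior t)"
  by (cases t) (auto intro!: open_Collect_conj open_Collect_less continuous_intros)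

lemma sampling_interior_subset: "sampling_interior t \<subseteq> sampling_space t"
  by (cases t) auto

lemma sampling_space_borel: "sampling_space t \<in> sets borel"
  by (cases t) auto

lemma negligible_sampling_boundary: "negligible (sampling_space t - sampling_interior t)"
proof (rule negligible_subset)
  show "negligible ({s :: real^2. s $ 1 = 0} \<union> {s. s $ 2 = 0})"
    by (intro negligible_Un negligible_standard_hyperplane_cart)
  show "sampling_space t - sampling_interior t \<subseteq> {s :: real^2. s $ 1 = 0} \<union> {s. s $ 2 = 0}"
    by (cases t) auto
qed

text \<open>For the cobweb the determinant is \<open>r * sqrt l1 * sqrt l2\<close>: the angle and
  the unit eigenvector each contribute a sum of squares equal to 1.\<close>

lemma det_f_sigma_jacobian_nonzero:
  assumes t: "valid_sampling F t" and s: "s \<in> sampling_interior t"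
  shows "det (f_sigma_jacobian t s) \<noteq> 0"
proof (cases t)
  case (Cobweb x l1 l2 v)
  have l: "0 < l1" "0 < l2" and v: "norm v = 1" using t Cobweb by auto
  have v1: "(v $ 1)\<^sup>2 + (v $ 2)\<^sup>2 = 1"
    using v by (simp add: norm_eq_1 inner_vec_def sum_2 power2_eq_square)
  define p q a b C S where pq: "p = sqrt l1" "q = sqrt l2" "a = v $ 1" "b = v $ 2" "C = cos (s $ 2)" "S = sin (s $ 2)"
  have "det (f_sigma_jacobian t s) = s $ 1 * ((p * C * a - q * S * b) * (q * C * a - p * S * b) + (p * S * a + q * C * b) * (q * S * a + p * C * b))"
    unfolding Cobweb f_sigma_jacobian.simps det_2 vector_2 pq by (simp add: algebra_simps)
  also have "\<dots> = s $ 1 * (p * q * ((C\<^sup>2 + S\<^sup>2) * (a\<^sup>2 + b\<^sup>2)))"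
    by (simp add: power2_eq_square algebra_simps)
  also have "\<dots> = s $ 1 * (p * q)" using v1 by (simp add: pq)
  finally show ?thesis using l s Cobweb by (simp add: pq)
qed (auto simp: det_2 mat_def)

text \<open>In the cobweb case, with \<open>X = r cos \<theta>\<close> and
  \<open>Y = r sin \<theta>\<close>, the map is \<open>p X (a, b) + q Y (-b, a)\<close> plus a
  constant. The two vectors are orthonormal, so projecting on them recovers \<open>X\<close> and
  \<open>Y\<close>, hence the polar coordinates.\<close>

lemma inj_on_f_sigma:
  assumes t: "valid_sampling F t"
  shows "inj_on (f_sigma t) (sampling_interior t)"
proof (cases t)
  case (Cobweb x l1 l2 v)
  have l: "0 < l1" "0 < l2" and v: "norm v = 1" using t Cobweb by auto
  have v1: "(v $ 1)\<^sup>2 + (v $ 2)\<^sup>2 = 1"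
    using v by (simp add: norm_eq_1 inner_vec_def sum_2 power2_eq_square)
  define p q a b where pq: "p = sqrt l1" "q = sqrt l2" "a = v $ 1" "b = v $ 2"
  have pq0: "p \<noteq> 0" "q \<noteq> 0" using l by (auto simp: pq)
  show ?thesis
  proof (rule inj_onI)
    fix s s' assume s: "s \<in> sampling_interior t" "s' \<in> sampling_interior t" and eq: "f_sigma t s = f_sigma t s'"
    define X Y X' Y' where XY: "X = s $ 1 * cos (s $ 2)" "Y = s $ 1 * sin (s $ 2)" "X' = s' $ 1 * cos (s' $ 2)" "Y' = s' $ 1 * sin (s' $ 2)"
    have 1: "p * X * a - q * Y * b = p * X' * a - q * Y' * b"
      using arg_cong[OF eq, of "\<lambda>z. z $ 1"] unfolding Cobweb f_sigma_cobweb_vector pq XY vector_2 by (simp add: algebra_simps)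
    have 2: "q * Y * a + p * X * b = q * Y' * a + p * X' * b"
      using arg_cong[OF eq, of "\<lambda>z. z $ 2"] unfolding Cobweb f_sigma_cobweb_vector pq XY vector_2 by (simp add: algebra_simps)
    have "p * X * (a\<^sup>2 + b\<^sup>2) = p * X' * (a\<^sup>2 + b\<^sup>2)" using 1 2 by algebra
    then have X: "X = X'" using v1 pq0 by (simp add: pq(3,4))
    have "q * Y * (a\<^sup>2 + b\<^sup>2) = q * Y' * (a\<^sup>2 + b\<^sup>2)" using 1 2 by algebra
    then have Y: "Y = Y'" using v1 pq0 by (simp add: pq(3,4))
    have pos: "0 < s $ 1" "0 < s' $ 1" "0 < s $ 2" "s $ 2 < 2 * pi" "0 < s' $ 2" "s' $ 2 < 2 * pi"
      using s Cobweb by auto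
    have "(s $ 1)\<^sup>2 * ((cos (s $ 2))\<^sup>2 + (sin (s $ 2))\<^sup>2) = (s' $ 1)\<^sup>2 * ((cos (s' $ 2))\<^sup>2 + (sin (s' $ 2))\<^sup>2)"
      using X Y unfolding XY by algebra
    then have r: "s $ 1 = s' $ 1" using pos by (simp add: power2_eq_iff_nonneg)
    then have "sin (s $ 2) = sin (s' $ 2) \<and> cos (s $ 2) = cos (s' $ 2)" using X Y pos by (simp add: XY)
    then obtain n :: int where n: "s $ 2 = s' $ 2 + 2 * pi * n" by (auto simp: sin_cos_eq_iff)
    \<comment> \<open>Both angles lie in an open interval of length \<open>2 * pi\<close>, so they
      differ by less than a full turn.\<close>
    then have "\<bar>2 * pi * n\<bar> < 2 * pi * 1" using pos by linarith
    then have "\<bar>real_of_int n\<bar> < 1" by (simp add: abs_mult)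
    then have "n = 0" by linarith
    with r n show "s = s'" by (simp add: vec_eq_iff forall_2)
  qed
qed (auto simp: inj_on_def vec_eq_iff forall_2 powr_inj)

section \<open>The density of the sample\<close>

theorem theorem3p10:
  fixes F :: "orbit \<Rightarrow> real^'m"
    and step :: "real^2 \<Rightarrow> attributable \<Rightarrow> attributable"
    and init :: "real^2 \<Rightarrow> attributable"
    and AR K K' D :: "(real^2) set"
    and Astar :: "real^2 \<Rightarrow> attributable"
    and DA :: "real^2 \<Rightarrow> real^2^4"
    and M :: "orbit set"
    and t :: sampling
    and P :: "'w measure"
    and X :: "'w \<Rightarrow> orbit"
    and S :: "'w \<Rightarrow> real^2"
    and c :: real
    and w :: "real^2 \<Rightarrow> real"
  assumes m: "CARD('m) \<ge> 6"
    and smooth: "C1_residuals F"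
    and admissible: "compact AR" "AR \<subseteq> range_space" "K \<subseteq> AR"
    and K': "K' = dc_domain F step init K"
    and K'_borel: "K' \<in> sets borel"
    and Astar: "Astar = dc_solution step init"
    and Astar_deriv: "\<And>\<rho>. \<rho> \<in> K' \<Longrightarrow> has_attr_jacobian Astar (DA \<rho>) \<rho> K'"
    and Astar_C1: "continuous_on K' DA"
    and M: "M = mov_param Astar ` K'"
    and min_attained: "\<exists>x\<in>M. \<forall>y\<in>M. target F x \<le> target F y"
    and sampling: "valid_sampling F t"
    and prob: "prob_space P"
    and X: "distributed P (surface_measure M) X (\<lambda>x. ennreal (c * exp (- (chi F M x)\<^sup>2 / 2)))"
    and S: "S \<in> P \<rightarrow>\<^sub>M restrict_space lborel (sampling_space t)"
    and S_X: "AE \<omega> in P. mov_param Astar (f_sigma t (S \<omega>)) = X \<omega>"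
    and D: "D = {s \<in> sampling_space t. f_sigma t s \<in> K'}"
    and w: "\<And>s. w s = exp (- (chi F M (mov_param Astar (f_sigma t s)))\<^sup>2 / 2)
                       * sqrt (gram_mu DA (f_sigma t s)) * sqrt (gram_sigma t s)"
  shows "distributed P (restrict_space lborel (sampling_space t)) S
           (\<lambda>s. ennreal (if s \<in> D then w s / (LINT u:D|lborel. w u) else 0))
         \<and> (\<forall>s\<in>D. sqrt (gram_sigma t s) = \<bar>det (jacobian (f_sigma t) (at s))\<bar>)"
proof
  define J where "J = f_sigma_jacobian t"
  have J: "jacobian (f_sigma t) (at s) = J s" for s
    unfolding J_def by (rule jacobian_eqI) (rule f_sigma_has_derivative)
  have gram_sigma: "sqrt (gram_sigma t s) = \<bar>det (J s)\<bar>" for s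
    by (simp add: gram_sigma_def J det_mul Let_def)
  then show "\<forall>s\<in>D. sqrt (gram_sigma t s) = \<bar>det (jacobian (f_sigma t) (at s))\<bar>"
    by (simp add: J)

  \<comment> \<open>Hausdorff measure and the constants of the density\<close>
  interpret prob_space P by (rule prob)
  define p where "p x = ennreal (c * exp (- (chi F M x)\<^sup>2 / 2))" for x
  define h where "h s = mov_param Astar (f_sigma t s)" for s
  define \<Omega> where "\<Omega> = sampling_space t"
  define W where "W = sampling_interior t"
  define S' where "S' = D \<inter> W"
  let ?N = "restrict_space lborel \<Omega>"
  define \<nu> where "\<nu> = (measure_of UNIV (sets borel) hausdorff2 :: orbit measure)"
  have ms: "measure_space UNIV (sets borel) (hausdorff2 :: orbit set \<Rightarrow> ennreal)"
    by (rule hausdorff2_measure_space[OF prob X])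
  note \<nu> = emeasure_hausdorff2_measure_of[OF ms, folded \<nu>_def]
  have space_\<nu>: "space \<nu> = UNIV" by (simp add: \<nu>_def)
  have surface: "surface_measure M = restrict_space \<nu> M" by (simp add: surface_measure_def \<nu>_def)
  obtain C where C: "C < \<infinity>" "\<And>E :: (real^2) set. E \<in> sets borel \<Longrightarrow> hausdorff2 E = C * emeasure lborel E"
    using hausdorff2_eq_lborel_prod[OF ms] by blast
  then obtain r where r: "0 \<le> r" "C = ennreal r" by (cases C) auto
  have X': "distributed P (restrict_space \<nu> M) X p"
    using X by (simp add: surface p_def[abs_def])
  then have p_meas: "p \<in> borel_measurable (restrict_space \<nu> M)" and X_meas: "X \<in> P \<rightarrow>\<^sub>M restrict_space \<nu> M"
    by (auto simp: distributed_def)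
  \<comment> \<open>\<open>ennreal\<close> sends negative numbers to 0, so \<open>c \<le> 0\<close>
    would give the zero density, incompatible with total mass 1.\<close>
  have c: "0 < c"
  proof (rule ccontr)
    assume "\<not> 0 < c"
    then have "p x = 0" for x by (simp add: p_def ennreal_eq_0_iff mult_nonpos_nonneg)
    then show False using distributed_imp_emeasure_nonzero[OF X'] by simp
  qed

  \<comment> \<open>Borel sets and the area formula for the sampled part of the manifold\<close>
  have contA: "continuous_on K' Astar"
    using continuous_on_has_attr_jacobian Astar_deriv .
  have M_borel: "M \<in> sets borel"
    unfolding M by (rule mov_param_image_borel[OF contA K'_borel])
  have cont_f: "continuous_on B (f_sigma t)" for B
    using f_sigma_has_derivative[of t] has_derivative_continuous_on[of B "f_sigma t" "\<lambda>s h. f_sigma_jacobian t s *v h"]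
      has_derivative_at_withinI by blast
  have \<Omega>_borel: "\<Omega> \<in> sets borel" unfolding \<Omega>_def by (rule sampling_space_borel)
  have "f_sigma t \<in> borel \<rightarrow>\<^sub>M borel" using cont_f by (rule borel_measurable_continuous_onI)
  from measurable_sets[OF this K'_borel] have "\<Omega> \<inter> f_sigma t -` K' \<in> sets borel"
    using \<Omega>_borel by simp
  moreover have "D = \<Omega> \<inter> f_sigma t -` K'" unfolding D \<Omega>_def by auto
  ultimately have D_borel: "D \<in> sets borel" by simp
  have open_W: "open W" and W_\<Omega>: "W \<subseteq> \<Omega>" and neg: "negligible (\<Omega> - W)" and inj: "inj_on (f_sigma t) W"
    unfolding W_def \<Omega>_def
    by (rule open_sampling_interior sampling_interior_subset negligible_sampling_boundary inj_on_f_sigma[OF sampling])+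
  have S'_borel: "S' \<in> sets borel" unfolding S'_def using D_borel open_W by auto
  have fD: "f_sigma t ` D \<subseteq> K'" and D_\<Omega>: "D \<subseteq> \<Omega>" unfolding D \<Omega>_def by auto

  obtain g where homW: "homeomorphism W (f_sigma t ` W) (f_sigma t) g"
    using invariance_of_domain_homeomorphism[OF open_W cont_f _ inj] by auto
  have "f_sigma t ` W \<in> sets borel"
    using invariance_of_domain[OF cont_f open_W inj] by simp
  then have fS': "f_sigma t ` S' \<in> sets borel"
    by (rule homeomorphism_borel_image[OF homW _ S'_borel]) (simp add: S'_def)
  have hom: "homeomorphism S' (f_sigma t ` S') (f_sigma t) g"
    by (rule homeomorphism_of_subsets[OF homW _ subset_refl refl]) (simp add: S'_def)
  have fS'K: "f_sigma t ` S' \<subseteq> K'" using fD by (auto simp: S'_def)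
  have detJ: "det (J s) \<noteq> 0" if "s \<in> S'" for s
    using that det_f_sigma_jacobian_nonzero[OF sampling] by (auto simp: J_def S'_def W_def)
  have derJ: "(f_sigma t has_derivative (\<lambda>h. J s *v h)) (at s within B)" for s B
    unfolding J_def by (rule has_derivative_at_withinI) (rule f_sigma_has_derivative)
  have contJ: "continuous_on B J" for B unfolding J_def by (rule continuous_on_f_sigma_jacobian)
  note area0 = mov_param_area[OF \<nu> C(2) Astar_deriv Astar_C1 S'_borel fS' fS'K hom derJ contJ detJ, folded h_def]
  have hom_h: "homeomorphism S' (h ` S') h (\<lambda>x. g (snd x))"
    by (rule area0(1))
  have hS'_borel: "h ` S' \<in> sets borel"
    by (rule area0(2))
  have area_h: "emeasure \<nu> (h ` E) = C * (\<integral>\<^sup>+s\<in>E. ennreal (sqrt (gram_mu DA (f_sigma t s)) * \<bar>det (J s)\<bar>) \<partial>lborel)"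
    if "E \<in> sets borel" "E \<subseteq> S'" for E
    by (rule area0(3)) (use that in auto)
  have hM: "h ` D \<subseteq> M" using fD by (auto simp: M h_def)
  then have hS'M: "h ` S' \<subseteq> M" by (auto simp: S'_def)

  \<comment> \<open>Almost sure avoidance of the sampling boundary\<close>
  have "negligible (f_sigma t ` (\<Omega> - W))"
    by (rule negligible_differentiable_image_negligible[OF order_refl neg])
      (use derJ in \<open>auto simp: differentiable_on_def differentiable_def\<close>)
  then obtain Z where Z: "Z \<in> null_sets lborel" "f_sigma t ` (\<Omega> - W) \<subseteq> Z"
    unfolding negligible_iff_null_sets null_sets_completion_iff2 by blast
  \<comment> \<open>The part of the manifold above the image of the boundary, enlarged to the Borel
    null set \<open>Z\<close> so that it is Borel itself.\<close>
  define Y0 where "Y0 = mov_param Astar ` (K' \<inter> Z)"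
  have KZ: "K' \<inter> Z \<in> sets borel" using K'_borel Z by (auto simp: null_sets_def)
  have Y0: "Y0 \<in> sets borel"
    unfolding Y0_def by (intro mov_param_image_borel KZ continuous_on_subset[OF contA]) auto
  have "emeasure \<nu> Y0 = 0"
  proof -
    have id: "homeomorphism K' ((\<lambda>x. x) ` K') (\<lambda>x. x) (\<lambda>x. x)" by (simp add: homeomorphism_ident)
    have "emeasure \<nu> Y0 = C * (\<integral>\<^sup>+\<rho>\<in>K' \<inter> Z. ennreal (sqrt (gram_mu DA \<rho>) * \<bar>det (mat 1 :: real^2^2)\<bar>) \<partial>lborel)"
      unfolding Y0_def
      by (rule mov_param_area(3)[OF \<nu> C(2) Astar_deriv Astar_C1 K'_borel _ _ id]) (use K'_borel KZ in auto)
    also have "(\<integral>\<^sup>+\<rho>\<in>K' \<inter> Z. ennreal (sqrt (gram_mu DA \<rho>) * \<bar>det (mat 1 :: real^2^2)\<bar>) \<partial>lborel) = (\<integral>\<^sup>+\<rho>. 0 \<partial>(lborel :: (real^2) measure))"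
      using AE_not_in[OF Z(1)] by (intro nn_integral_cong_AE) (auto elim!: eventually_mono)
    finally show ?thesis by simp
  qed
  have X_notin: "AE \<omega> in P. X \<omega> \<notin> Y0"
  proof -
    have "Y0 \<subseteq> M" by (auto simp: Y0_def M)
    then have Y0_sets: "Y0 \<in> sets (restrict_space \<nu> M)" using Y0 M_borel by (simp add: sets_restrict_space_iff \<nu>(1))
    have "emeasure P (X -` Y0 \<inter> space P) = (\<integral>\<^sup>+x. p x * indicator Y0 x \<partial>restrict_space \<nu> M)"
      by (rule distributed_emeasure[OF X' Y0_sets])
    also have "\<dots> = (\<integral>\<^sup>+x. 0 \<partial>restrict_space \<nu> M)"
    proof (rule nn_integral_cong_AE)
      have "Y0 \<in> null_sets (restrict_space \<nu> M)"
        using \<open>emeasure \<nu> Y0 = 0\<close> \<open>Y0 \<subseteq> M\<close> Y0_sets M_borel by (auto simp: null_sets_def emeasure_restrict_space \<nu>(1))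
      from AE_not_in[OF this] show "AE x in restrict_space \<nu> M. p x * indicator Y0 x = 0"
        by eventually_elim simp
    qed
    finally have "X -` Y0 \<inter> space P \<in> null_sets P"
      using measurable_sets[OF X_meas Y0_sets] by (auto simp: null_sets_def)
    from AE_not_in[OF this] AE_space show ?thesis by eventually_elim simp
  qed

  \<comment> \<open>As \<open>X\<close> lies in \<open>M\<close>, the range component of the
    relation puts \<open>f_sigma t (S \<omega>)\<close> in \<open>K'\<close>; a value of
    \<open>S\<close> outside \<open>W\<close> would then place \<open>X\<close> in
    \<open>Y0\<close>.\<close>
  have S_in: "AE \<omega> in P. S \<omega> \<in> S' \<and> h (S \<omega>) = X \<omega>"
    using S_X X_notin AE_space
  proof eventually_elim
    case (elim \<omega>)
    have "S \<omega> \<in> \<Omega>" using measurable_space[OF S elim(3)] by (simp add: space_restrict_space \<Omega>_def)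
    have "X \<omega> \<in> M" using measurable_space[OF X_meas elim(3)] by (simp add: space_restrict_space)
    then obtain \<rho> where "\<rho> \<in> K'" "X \<omega> = mov_param Astar \<rho>" by (auto simp: M)
    with elim(1) have f: "f_sigma t (S \<omega>) \<in> K'" by (auto simp: mov_param_def)
    have "S \<omega> \<in> W"
    proof (rule ccontr)
      assume "S \<omega> \<notin> W"
      with \<open>S \<omega> \<in> \<Omega>\<close> Z(2) f have "f_sigma t (S \<omega>) \<in> K' \<inter> Z" by auto
      then have "X \<omega> \<in> Y0" unfolding Y0_def elim(1)[symmetric] by (rule imageI)
      with elim(2) show False by simp
    qed
    with f \<open>S \<omega> \<in> \<Omega>\<close> elim(1) show ?case by (simp add: S'_def D \<Omega>_def h_def)
  qed

  \<comment> \<open>Measurability of the weight\<close>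
  have h_D: "h \<in> restrict_space borel D \<rightarrow>\<^sub>M restrict_space \<nu> M"
  proof (rule measurable_restrict_space2)
    show "h \<in> space (restrict_space borel D) \<rightarrow> M" using hM by (auto simp: space_restrict_space)
    have "continuous_on D (\<lambda>s. Astar (f_sigma t s))"
      using contA cont_f fD by (rule continuous_on_compose2)
    then have "h \<in> restrict_space borel D \<rightarrow>\<^sub>M borel"
      unfolding h_def mov_param_def by (intro borel_measurable_continuous_on_restrict continuous_intros cont_f)
    then show "h \<in> restrict_space borel D \<rightarrow>\<^sub>M \<nu>" using \<nu>(1) by (simp cong: measurable_cong_sets)
  qed
  have gram_pos: "0 < gram_mu DA \<rho>" for \<rho>
    using det_gram_factor_pos[of "DA \<rho>"] by (simp add: det_gram_factor gram_mu_def)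
  define G where "G s = sqrt (gram_mu DA (f_sigma t s)) * \<bar>det (J s)\<bar>" for s
  have G0: "0 \<le> G s" for s using gram_pos[of "f_sigma t s"] by (simp add: G_def)
  have contG: "continuous_on D G"
  proof -
    have "continuous_on D (\<lambda>s. DA (f_sigma t s))"
      using Astar_C1 cont_f fD by (rule continuous_on_compose2)
    then have "continuous_on D (\<lambda>s. det (gram_factor (DA (f_sigma t s))) * \<bar>det (J s)\<bar>)"
      by (intro continuous_intros continuous_on_det_2 continuous_on_gram_factor contJ)
    then show ?thesis by (simp add: G_def[abs_def] det_gram_factor gram_mu_def)
  qed
  have wG: "w s = exp (- (chi F M (h s))\<^sup>2 / 2) * G s" for s
    by (simp add: w h_def G_def gram_sigma)
  have pG: "p (h s) * ennreal (G s) = ennreal (c * w s)" for s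
    using c G0 by (simp add: p_def wG ennreal_mult[symmetric] mult.assoc)
  have w0: "0 \<le> w s" for s using G0 by (simp add: wG)
  \<comment> \<open>The exponential is recovered from the density \<open>p\<close>, whose
    measurability is part of the hypothesis on \<open>X\<close>.\<close>
  have w_p: "w s = enn2real (p (h s)) / c * G s" for s
    using c by (simp add: wG p_def)
  have w_D: "w \<in> borel_measurable (restrict_space borel D)"
  proof -
    have "(\<lambda>s. p (h s)) \<in> borel_measurable (restrict_space borel D)"
      using h_D p_meas by (rule measurable_compose)
    moreover have "G \<in> borel_measurable (restrict_space borel D)"
      using contG by (rule borel_measurable_continuous_on_restrict)
    ultimately show ?thesis unfolding w_p[abs_def] by measurable
  qed
  define wD where "wD s = indicator D s *\<^sub>R w s" for s
  have wD[measurable]: "wD \<in> borel_measurable borel"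
    using w_D D_borel unfolding wD_def by (subst (asm) borel_measurable_restrict_space_iff) auto

  \<comment> \<open>The laws of \<open>X\<close> and \<open>S\<close> up to normalisation\<close>
  have law_X: "emeasure P (X -` h ` E \<inter> space P) = ennreal (r * c) * (\<integral>\<^sup>+s\<in>E. ennreal (w s) \<partial>lborel)"
    if E: "E \<in> sets borel" "E \<subseteq> S'" for E
  proof -
    let ?q = "\<lambda>x. p x * indicator (h ` E) x"
    have hE: "h ` E \<in> sets borel" using homeomorphism_borel_image[OF hom_h hS'_borel E] .
    have hE': "h ` E \<subseteq> h ` S'" using E by auto
    have "h ` E \<in> sets (restrict_space \<nu> M)" using hE hE' hS'M M_borel by (auto simp: sets_restrict_space_iff \<nu>(1))
    then have "emeasure P (X -` h ` E \<inter> space P) = (\<integral>\<^sup>+x. ?q x \<partial>restrict_space \<nu> M)"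
      by (rule distributed_emeasure[OF X'])
    \<comment> \<open>The integrand vanishes off the image of \<open>E\<close>, so \<open>M\<close>
      shrinks to the image of \<open>S'\<close>, on which \<open>h\<close> is invertible.\<close>
    also have "\<dots> = (\<integral>\<^sup>+x. ?q x \<partial>restrict_space \<nu> (h ` S'))"
      using M_borel hS'_borel hE' hS'M
      by (simp add: nn_integral_restrict_space \<nu>(1)) (intro nn_integral_cong, auto split: split_indicator)
    also have "\<dots> = (\<integral>\<^sup>+s\<in>S'. (C * ennreal (G s)) * ?q (h s) \<partial>lborel)"
    proof (rule nn_integral_transfer[OF \<nu>(1) hom_h S'_borel hS'_borel])
      have "continuous_on S' G" using contG by (rule continuous_on_subset) (simp add: S'_def)
      then show "(\<lambda>s. C * ennreal (G s)) \<in> borel_measurable (restrict_space borel S')"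
        using borel_measurable_continuous_on_restrict by measurable
      have "restrict_space (restrict_space \<nu> M) (h ` S') = restrict_space \<nu> (h ` S')"
        using M_borel hS'_borel hS'M by (simp add: restrict_restrict_space \<nu>(1) Int_absorb1)
      then have "p \<in> borel_measurable (restrict_space \<nu> (h ` S'))"
        using measurable_restrict_space1[OF p_meas, of "h ` S'"] by simp
      moreover have "h ` E \<in> sets (restrict_space \<nu> (h ` S'))"
        using hE hE' hS'_borel by (simp add: sets_restrict_space_iff \<nu>(1))
      ultimately show "?q \<in> borel_measurable (restrict_space \<nu> (h ` S'))" by measurable
      fix E' assume E': "E' \<in> sets borel" "E' \<subseteq> S'"
      have "continuous_on E' G" using contG by (rule continuous_on_subset) (use E' in \<open>auto simp: S'_def\<close>)
      then have "(\<lambda>s. ennreal (G s)) \<in> borel_measurable (restrict_space borel E')"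
        using borel_measurable_continuous_on_restrict by measurable
      then have "(\<lambda>s. ennreal (G s) * indicator E' s) \<in> borel_measurable borel"
        using E' by (simp add: borel_measurable_restrict_space_iff_ennreal)
      then show "emeasure \<nu> (h ` E') = (\<integral>\<^sup>+s\<in>E'. C * ennreal (G s) \<partial>lborel)"
        using area_h[OF E'] by (simp add: G_def nn_integral_cmult mult.assoc)
    qed
    also have "\<dots> = (\<integral>\<^sup>+s. ennreal (r * c) * (ennreal (w s) * indicator E s) \<partial>lborel)"
    proof (rule nn_integral_cong)
      fix s
      have inj_h: "s \<in> E" if "s \<in> S'" "h s \<in> h ` E"
        using that E hom_h by (auto simp: homeomorphism_def) (metis subsetD)
      have "C * (p (h s) * ennreal (G s)) = ennreal (r * c) * ennreal (w s)"
        unfolding pG r using r c w0 by (simp add: ennreal_mult[symmetric] mult.assoc)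
      then have "C * ennreal (G s) * p (h s) = ennreal (r * c) * ennreal (w s)"
        by (simp add: mult_ac)
      then show "C * ennreal (G s) * ?q (h s) * indicator S' s = ennreal (r * c) * (ennreal (w s) * indicator E s)"
        using E inj_h by (auto split: split_indicator)
    qed
    also have "\<dots> = ennreal (r * c) * (\<integral>\<^sup>+s\<in>E. ennreal (w s) \<partial>lborel)"
    proof (rule nn_integral_cmult)
      have "(\<lambda>s. ennreal (wD s) * indicator E s) \<in> borel_measurable lborel" using E by measurable
      also have "(\<lambda>s. ennreal (wD s) * indicator E s) = (\<lambda>s. ennreal (w s) * indicator E s)"
        using E by (auto simp: fun_eq_iff wD_def S'_def split: split_indicator)
      finally show "(\<lambda>s. ennreal (w s) * indicator E s) \<in> borel_measurable lborel" .
    qed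
    finally show ?thesis .
  qed

  have law_S: "emeasure P (S -` B \<inter> space P) = ennreal (r * c) * (\<integral>\<^sup>+s\<in>B. ennreal (wD s) \<partial>lborel)"
    if B: "B \<in> sets borel" "B \<subseteq> \<Omega>" for B
  proof -
    let ?E = "B \<inter> S'"
    have E: "?E \<in> sets borel" "?E \<subseteq> S'" using B S'_borel by auto
    \<comment> \<open>Injectivity of \<open>h\<close> on \<open>S'\<close> turns an event about
      \<open>S\<close> into one about \<open>X\<close>, up to a null event.\<close>
    have "emeasure P (S -` B \<inter> space P) = emeasure P (X -` h ` ?E \<inter> space P)"
    proof (rule emeasure_eq_AE)
      show "AE \<omega> in P. \<omega> \<in> S -` B \<inter> space P \<longleftrightarrow> \<omega> \<in> X -` h ` ?E \<inter> space P"
        using S_in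
      proof eventually_elim
        case (elim \<omega>)
        have "S \<omega> = s" if "s \<in> S'" "h (S \<omega>) = h s" for s
          using that elim hom_h unfolding homeomorphism_def by metis
        then have "h (S \<omega>) \<in> h ` ?E \<longleftrightarrow> S \<omega> \<in> B" using elim by blast
        then show ?case using elim by (simp only: vimage_eq Int_iff)
      qed
      show "S -` B \<inter> space P \<in> sets P"
        using S B \<Omega>_borel by (intro measurable_sets[OF S]) (auto simp: sets_restrict_space_iff \<Omega>_def)
      have "h ` ?E \<in> sets borel" using homeomorphism_borel_image[OF hom_h hS'_borel E] .
      then show "X -` h ` ?E \<inter> space P \<in> sets P"
        using hS'M M_borel by (intro measurable_sets[OF X_meas]) (auto simp: sets_restrict_space_iff \<nu>(1))
    qed
    also have "\<dots> = ennreal (r * c) * (\<integral>\<^sup>+s\<in>?E. ennreal (w s) \<partial>lborel)"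
      by (rule law_X[OF E])
    \<comment> \<open>\<open>D - S'\<close> lies in the negligible boundary, so the weight may be
      taken over all of \<open>D\<close>.\<close>
    also have "(\<integral>\<^sup>+s\<in>?E. ennreal (w s) \<partial>lborel) = (\<integral>\<^sup>+s\<in>B. ennreal (wD s) \<partial>lborel)"
    proof (rule nn_integral_cong_AE)
      obtain N where N: "N \<in> null_sets lborel" "\<Omega> - W \<subseteq> N"
        using neg unfolding negligible_iff_null_sets null_sets_completion_iff2 by blast
      show "AE s in lborel. ennreal (w s) * indicator ?E s = ennreal (wD s) * indicator B s"
        using AE_not_in[OF N(1)]
        by eventually_elim (use N(2) D_\<Omega> in \<open>auto simp: wD_def S'_def split: split_indicator\<close>)
    qed
    finally show ?thesis .
  qed

  \<comment> \<open>Normalisation\<close>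
  define I where "I = (LINT u:D|lborel. w u)"
  \<comment> \<open>Evaluating the law of \<open>S\<close> on the whole sampling space. A product
    equal to 1 forces the Hausdorff constant \<open>r\<close> to be positive and the integral to be
    finite, and it fixes \<open>r * c\<close> as the reciprocal of that integral.\<close>
  have V: "ennreal (r * c) * (\<integral>\<^sup>+s. ennreal (wD s) \<partial>lborel) = 1"
  proof -
    have "S -` \<Omega> \<inter> space P = space P"
      using measurable_space[OF S] by (auto simp: space_restrict_space \<Omega>_def)
    moreover have "(\<integral>\<^sup>+s\<in>\<Omega>. ennreal (wD s) \<partial>lborel) = (\<integral>\<^sup>+s. ennreal (wD s) \<partial>lborel)"
      using D_\<Omega> by (intro nn_integral_cong) (auto simp: wD_def split: split_indicator)
    ultimately show ?thesis
      using law_S[OF \<Omega>_borel order_refl] emeasure_space_1 by simp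
  qed
  have rc: "0 < r * c"
    using V r c by (cases "r = 0") auto
  have wD0: "0 \<le> wD s" for s using w0 by (simp add: wD_def)
  have "(\<integral>\<^sup>+s. ennreal (wD s) \<partial>lborel) \<noteq> top"
    using V rc by (auto simp: ennreal_mult_top split: if_splits)
  then obtain v where v: "(\<integral>\<^sup>+s. ennreal (wD s) \<partial>lborel) = ennreal v" "0 \<le> v"
    by (cases "\<integral>\<^sup>+s. ennreal (wD s) \<partial>lborel") auto
  have "I = v"
    unfolding I_def set_lebesgue_integral_def wD_def[symmetric]
    using wD0 v by (subst integral_eq_nn_integral) auto
  moreover have "r * c * v = 1"
    using V v rc by (simp add: ennreal_mult[symmetric] ennreal_eq_1)
  ultimately have I: "r * c = 1 / I" by (intro eq_divide_imp) auto

  define d where "d s = ennreal (if s \<in> D then w s / I else 0)" for s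
  have d: "d s = ennreal (r * c) * ennreal (wD s)" for s
    using rc wD0 by (auto simp: d_def I wD_def ennreal_mult[symmetric] split: split_indicator)
  have d_meas: "d \<in> borel_measurable ?N"
    unfolding d[abs_def] by (intro measurable_restrict_space1) measurable
  have S'': "S \<in> P \<rightarrow>\<^sub>M ?N" using S by (simp add: \<Omega>_def)
  have "distr P ?N S = density ?N d"
  proof (rule measure_eqI)
    fix B assume "B \<in> sets (distr P ?N S)"
    then have B': "B \<in> sets ?N" by simp
    then have B: "B \<in> sets borel" "B \<subseteq> \<Omega>" using \<Omega>_borel by (auto simp: sets_restrict_space_iff)
    have "emeasure (distr P ?N S) B = ennreal (r * c) * (\<integral>\<^sup>+s\<in>B. ennreal (wD s) \<partial>lborel)"
      using S'' B' law_S[OF B] by (simp add: emeasure_distr)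
    also have "\<dots> = (\<integral>\<^sup>+s. d s * indicator B s \<partial>lborel)"
      using B by (subst nn_integral_cmult[symmetric]) (auto simp: d mult.assoc)
    also have "\<dots> = (\<integral>\<^sup>+s. d s * indicator B s \<partial>?N)"
      using B \<Omega>_borel by (subst nn_integral_restrict_space) (auto intro!: nn_integral_cong split: split_indicator)
    also have "\<dots> = emeasure (density ?N d) B"
      using d_meas B' by (simp add: emeasure_density)
    finally show "emeasure (distr P ?N S) B = emeasure (density ?N d) B" .
  qed simp
  then show "distributed P (restrict_space lborel (sampling_space t)) S
      (\<lambda>s. ennreal (if s \<in> D then w s / (LINT u:D|lborel. w u) else 0))"
    using d_meas S'' unfolding distributed_def \<Omega>_def[symmetric] I_def[symmetric] d_def[symmetric] by simp
qed

end
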